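(* In the setting described in the context, let $\theta_0=(\alpha_0,\beta_0)$ be the true parameter value. Assume: (i) for each $\theta\in\Theta$, $\varphi(n)^{1/2}\,\ddot{\mathbb H}_n(\mathbf X_n,\theta)\,\varphi(n)^{1/2}\to\mathcal I(\theta)$ in probability as $n\to\infty$ (when $\theta$ is the true value); (ii) for each $\theta\in\Theta$ (when $\theta$ is the true value), $\tilde\theta_n=\arg\min_{\vartheta\in\Theta}\mathbb H_n(\mathbf X_n,\vartheta)$ is a consistent estimator of $\theta$ and $\varphi(n)^{-1/2}(\tilde\theta_n-\theta)\to N(0,\mathcal I(\theta)^{-1})$ in distribution as $n\to\infty$; (iii) $\dfrac{\mu_n}{\sqrt{n\Delta_n}}\to0$ and $\dfrac{\nu_n}{\sqrt n}\to0$ as $n\to\infty$, where $\mu_n=\max\{\lambda_{n,j}:1\le j\le p_0\}$ and $\nu_n=\max\{\gamma_{n,k}:1\le k\le q_0\}$; (iv) $\dfrac{\kappa_n}{\sqrt{n\Delta_n}}\to\infty$ and $\dfrac{\omega_n}{\sqrt n}\to\infty$ as $n\to\infty$, where $\kappa_n=\min\{\lambda_{n,j}:j>p_0\}$ and $\omega_n=\min\{\gamma_{n,k}:k>q_0\}$. Let $\hat\theta_n=(\hat\alpha_n,\hat\beta_n)=\arg\min_{\theta\in\Theta}\mathcal F(\theta)$ be the LASSO-type estimator, and let $\hat\theta_n^*=(\hat\alpha_{n,1},\dots,\hat\alpha_{n,p_0},\hat\beta_{n,1},\dots,\hat\beta_{n,q_0})$ and $\theta_0^*=(\alpha_{01},\dots,\alpha_{0p_0},\beta_{01},\dots,\beta_{0q_0})$.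 Then, as $n\to\infty$, $$\varphi_0(n)^{-1/2}(\hat\theta_n^*-\theta_0^* )\to N\big(0,\mathcal I_0^{-1}(\theta_0^* )\big)\quad\text{in distribution.}$$
   Context: **Model.** Let $p,q,d\ge1$, $\Theta_p\subset\mathbb R^p$, $\Theta_q\subset\mathbb R^q$, $\Theta=\Theta_p\times\Theta_q$. Let $X_t$ be a $d$-dimensional diffusion solving $dX_t=b(\alpha,X_t)\,dt+\sigma(\beta,X_t)\,dW_t$, where $b:\Theta_p\times\mathbb R^d\to\mathbb R^d$ and $\sigma:\Theta_q\times\mathbb R^d\to\mathbb R^{d\times d}$ are known functions and $W$ is a standard Brownian motion in $\mathbb R^d$. Write $\theta=(\alpha,\beta)\in\Theta$ and let $\theta_0=(\alpha_0,\beta_0)$ be the unknown true value. For a matrix $A$, $A^{\otimes2}=AA'$; $\Sigma(\beta,x)=\sigma(\beta,x)^{\otimes2}$. Parameter vectors are row vectors and $'$ denotes transpose. **Observations.** $\mathbf X_n=(X_{t_i})_{0\le i\le n}$ with $t_0=0$, $t_i-t_{i-1}=\Delta_n<\infty$. As $n\to\infty$: $n\Delta_n\to\infty$, $\Delta_n\to0$ and $n\Delta_n^2\to0$. **Standing regularity assumptions.** 1. There is a constant $C$ with $|b(\alpha_0,x)-b(\alpha_0,y)|+|\sigma(\beta_0,x)-\sigma(\beta_0,y)|\le C|x-y|$ for all $x,y$. 2. $\inf_{\beta,x}\det\Sigma(\beta,x)>0$. 3. $X$ is ergodic for every $\theta$ with invariant probability measure $\mu_\theta$. 4. For all $m\ge0$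 and all $\theta$, $\sup_tE|X_t|^m<\infty$. 5. For every $\theta$, $b(\alpha,x)$ and $\sigma(\beta,x)$ are five times differentiable in $x$, with derivatives bounded by a polynomial function in $x$, uniformly in $\theta$. 6. $b(\alpha,x)$, $\sigma(\beta,x)$ and all their partial derivatives in $x$ up to order 2 are three times differentiable in $\theta$ for all $x$ in the state space, and all derivatives with respect to $\theta$ are bounded by a polynomial function in $x$, uniformly in $\theta$. 7. If $b(\alpha,x)=b(\alpha_0,x)$ and $\sigma(\beta,x)=\sigma(\beta_0,x)$ for all $x$ ($\mu_{\theta_0}$-almost surely), then $\alpha=\alpha_0$ and $\beta=\beta_0$. **Information matrix and rates.** $\mathcal I(\theta)=\begin{pmatrix}\Gamma_\alpha&0\\0&\Gamma_\beta\end{pmatrix}$ is assumed positive definite (hence invertible), where $\Gamma_\alpha=[\mathcal I_b^{kj}(\alpha)]_{k,j=1,\dots,p}$, $\Gamma_\beta=[\mathcal I_\sigma^{kj}(\beta)]_{k,j=1,\dots,q}$ and $$\mathcal I_b^{kj}(\alpha)=\int(\partial_{\alpha_k}b(\alpha,x))'\,\Sigma(\beta,x)^{-1}\,\partial_{\alpha_j}b(\alpha,x)\,\mu_\theta(dx),$$ $$\mathcal I_\sigma^{kj}(\beta)=\tfrac12\int\mathrm{tr}\big(\Sigma^{-1}(\partial_{\beta_k}\Sigma)\Sigma^{-1}(\partial_{\beta_j}\Sigma)\big)(\beta,x)\,\mu_\theta(dx);$$ for $d=1$ these are $\int\sigma^{-2}\,\partial_{\alpha_k}b\,\partial_{\alpha_j}b\,d\mu_\theta$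 and $2\int\sigma^{-2}\,\partial_{\beta_k}\sigma\,\partial_{\beta_j}\sigma\,d\mu_\theta$. Also $\varphi(n)=\mathrm{diag}\big(\tfrac1{n\Delta_n}\mathbf I_p,\tfrac1n\mathbf I_q\big)$, with $\mathbf I_m$ the identity matrix of order $m$. **Contrast function.** For each $n$, $\mathbb H_n(\mathbf X_n,\theta)$ is a real-valued random field (a function of the sample $\mathbf X_n$ and of $\theta\in\Theta$) admitting first and second derivatives in $\theta$; $\ddot{\mathbb H}_n(\mathbf X_n,\theta)$ is its Hessian matrix in $\theta$. **Sparsity.** The true parameter satisfies $\alpha_{0j}\ne0$ for $1\le j\le p_0$, $\alpha_{0j}=0$ for $p_0<j\le p$, $\beta_{0k}\ne0$ for $1\le k\le q_0$, $\beta_{0k}=0$ for $q_0<k\le q$. **LASSO-type estimator.** With positive real tuning parameters $\lambda_{n,j}$ ($1\le j\le p$), $\gamma_{n,k}$ ($1\le k\le q$), $$\mathcal F(\theta)=(\theta-\tilde\theta_n)\,\ddot{\mathbb H}_n(\mathbf X_n,\tilde\theta_n)\,(\theta-\tilde\theta_n)'+\sum_{j=1}^p\lambda_{n,j}|\alpha_j|+\sum_{k=1}^q\gamma_{n,k}|\beta_k|,$$ and $\hat\theta_n=(\hat\alpha_n,\hat\beta_n)=\arg\min_{\theta\in\Theta}\mathcal F(\theta)$. **Submatrices for the true subset model.** $\mathcal I_0(\theta_0^* )$ is the $(p_0+q_0)\times(p_0+q_0)$ submatrix of $\mathcal I(\theta)$ at the true parameter value corresponding to the nonzero parameters: $$\mathcal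 I_0(\theta_0^* )=\begin{pmatrix}[\mathcal I_b^{kj}]_{k,j=1,\dots,p_0}&0\\0&[\mathcal I_\sigma^{kj}]_{k,j=1,\dots,q_0}\end{pmatrix}\Big|_{\theta=\theta_0},$$ and $\varphi_0(n)=\mathrm{diag}\big(\tfrac1{n\Delta_n}\mathbf I_{p_0},\tfrac1n\mathbf I_{q_0}\big)$.
   Formalization: Added to (i): at θ_0, φ(n)^{1/2}(Ḧ_n(X_n,θ̃_n)−Ḧ_n(X_n,θ_0))φ(n)^{1/2}→0 in probability; pointwise (i) says nothing at the random θ̃_n and the claim then fails. Also Θ_p, Θ_q are taken open and p_0+q_0≥1. *)

theory Defs
  imports "HOL-Probability.Probability"
begin

subsection \<open>Modes of convergence and Gaussian laws\<close>

text \<open>Measurability is part of the two convergence notions below, because the library's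
  \<^const>\<open>measure\<close> and Bochner integral return \<open>0\<close> on non-measurable arguments.\<close>

definition conv_in_prob ::
  "'w measure \<Rightarrow> ('i \<Rightarrow> 'w \<Rightarrow> 'a::metric_space) \<Rightarrow> ('w \<Rightarrow> 'a) \<Rightarrow> 'i filter \<Rightarrow> bool" where
  "conv_in_prob M Y Z F \<longleftrightarrow>
     (\<forall>\<^sub>F i in F. Y i \<in> borel_measurable M) \<and> Z \<in> borel_measurable M \<and>
     (\<forall>e>0. ((\<lambda>i. measure M {\<omega> \<in> space M. e < dist (Y i \<omega>) (Z \<omega>)}) \<longlongrightarrow> 0) F)"

definition conv_in_dist ::
  "'w measure \<Rightarrow> (nat \<Rightarrow> 'w \<Rightarrow> 'a::metric_space) \<Rightarrow> 'a measure \<Rightarrow> bool" where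
  "conv_in_dist M Y L \<longleftrightarrow>
     (\<forall>n. Y n \<in> borel_measurable M) \<and>
     (\<forall>f :: 'a \<Rightarrow> real. continuous_on UNIV f \<and> bounded (range f) \<longrightarrow>
        (\<lambda>n. \<integral>\<omega>. f (Y n \<omega>) \<partial>M) \<longlonglongrightarrow> (\<integral>y. f y \<partial>L))"

text \<open>Nondegenerate normal law with mean \<open>m\<close> and (positive definite) covariance matrix \<open>C\<close>.\<close>

definition multi_normal :: "real^'n \<Rightarrow> real^'n^'n \<Rightarrow> (real^'n) measure" where
  "multi_normal m C = density lborel (\<lambda>x. ennreal
     (exp (- ((x - m) \<bullet> (matrix_inv C *v (x - m))) / 2) / sqrt ((2 * pi) ^ CARD('n) * det C)))"

definition pos_definite :: "real^'n^'n \<Rightarrow> bool" where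
  "pos_definite A \<longleftrightarrow> transpose A = A \<and> (\<forall>v. v \<noteq> 0 \<longrightarrow> 0 < v \<bullet> (A *v v))"

definition diag_mat :: "('n \<Rightarrow> real) \<Rightarrow> real^'n^'n" where
  "diag_mat f = (\<chi> i j. if i = j then f i else 0)"


subsection \<open>Partial derivatives\<close>

definition partial :: "'n \<Rightarrow> (real^'n \<Rightarrow> 'a::real_normed_vector) \<Rightarrow> real^'n \<Rightarrow> 'a" where
  "partial i f x = vector_derivative (\<lambda>t. f (x + t *\<^sub>R axis i 1)) (at 0)"

definition partials :: "'n list \<Rightarrow> (real^'n \<Rightarrow> 'a::real_normed_vector) \<Rightarrow> real^'n \<Rightarrow> 'a" where
  "partials ks f = foldr partial ks f"

text \<open>A function is \<open>k\<close> times (Frechet) differentiable iff all its partial derivatives of order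
  less than \<open>k\<close>, itself included, are differentiable.\<close>

definition times_differentiable_on ::
  "nat \<Rightarrow> (real^'n \<Rightarrow> 'a::real_normed_vector) \<Rightarrow> (real^'n) set \<Rightarrow> bool" where
  "times_differentiable_on k f S \<longleftrightarrow>
     (\<forall>ks. length ks < k \<longrightarrow> (\<forall>x\<in>S. partials ks f differentiable (at x)))"

definition hessian :: "(real^'n \<Rightarrow> real) \<Rightarrow> real^'n \<Rightarrow> real^'n^'n" where
  "hessian f x = (\<chi> i j. partials [i, j] f x)"

definition poly_bounded ::
  "'t set \<Rightarrow> ('t \<Rightarrow> 'x::real_normed_vector \<Rightarrow> 'a::real_normed_vector) \<Rightarrow> bool" where
  "poly_bounded T g \<longleftrightarrow> (\<exists>C m. \<forall>t\<in>T. \<forall>x. norm (g t x) \<le> C * (1 + norm x ^ m))"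


subsection \<open>Brownian motion, stochastic differential equations, ergodicity\<close>

definition brownian_motion ::
  "'w measure \<Rightarrow> (real \<Rightarrow> 'w measure) \<Rightarrow> (real \<Rightarrow> 'w \<Rightarrow> real^'d) \<Rightarrow> bool" where
  "brownian_motion M F W \<longleftrightarrow>
     prob_space M \<and> filtration (space M) F \<and> (\<forall>t. subalgebra M (F t)) \<and>
     (\<forall>t\<ge>0. W t \<in> borel_measurable (F t)) \<and>
     (AE \<omega> in M. W 0 \<omega> = 0) \<and>
     (\<forall>\<omega>\<in>space M. continuous_on {0..} (\<lambda>t. W t \<omega>)) \<and>
     (\<forall>s t. 0 \<le> s \<and> s < t \<longrightarrow>
        distr M borel (\<lambda>\<omega>. W t \<omega> - W s \<omega>) = multi_normal 0 ((t - s) *\<^sub>R mat 1) \<and>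
        prob_space.indep_set M
          (sets (vimage_algebra (space M) (\<lambda>\<omega>. W t \<omega> - W s \<omega>) borel)) (sets (F s)))"

text \<open>\<open>I\<close> is the Ito integral of the matrix process \<open>Y\<close> over \<open>[0, t]\<close>. The definition as a limit in
  probability of left-point sums is meant for continuous adapted \<open>Y\<close>, where the limit exists and does
  not depend on the choice of partitions with vanishing mesh.\<close>

definition is_ito_integral ::
  "'w measure \<Rightarrow> (real \<Rightarrow> 'w \<Rightarrow> real^'d) \<Rightarrow> (real \<Rightarrow> 'w \<Rightarrow> real^'d^'d) \<Rightarrow> real \<Rightarrow> ('w \<Rightarrow> real^'d) \<Rightarrow> bool"
  where
  "is_ito_integral M W Y t I \<longleftrightarrow>
     conv_in_prob M
       (\<lambda>m \<omega>. \<Sum>k<m. Y (real k * t / real m) \<omega> *v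
          (W (real (Suc k) * t / real m) \<omega> - W (real k * t / real m) \<omega>))
       I sequentially"

text \<open>\<open>X\<close> solves \<open>dX = drift(X) dt + diff(X) dW\<close> (with continuous \<open>drift\<close>, \<open>diff\<close>).\<close>

definition sde_solution ::
  "'w measure \<Rightarrow> (real \<Rightarrow> 'w measure) \<Rightarrow> (real \<Rightarrow> 'w \<Rightarrow> real^'d) \<Rightarrow> (real \<Rightarrow> 'w \<Rightarrow> real^'d) \<Rightarrow>
   (real^'d \<Rightarrow> real^'d) \<Rightarrow> (real^'d \<Rightarrow> real^'d^'d) \<Rightarrow> bool" where
  "sde_solution M F W X drift diff \<longleftrightarrow>
     brownian_motion M F W \<and>
     (\<forall>t\<ge>0. X t \<in> borel_measurable (F t)) \<and>
     (\<forall>\<omega>\<in>space M. continuous_on {0..} (\<lambda>t. X t \<omega>)) \<and>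
     (\<forall>t\<ge>0. is_ito_integral M W (\<lambda>s \<omega>. diff (X s \<omega>)) t
        (\<lambda>\<omega>. X t \<omega> - X 0 \<omega> - integral {0..t} (\<lambda>s. drift (X s \<omega>))))"

text \<open>\<open>\<mu>\<close> is an invariant law for the equation (a solution started from \<open>\<mu>\<close> keeps this law), and time
  averages along \<open>X\<close> converge to space averages under \<open>\<mu>\<close>, whatever the initial law of \<open>X\<close>.\<close>

definition ergodic_diffusion ::
  "'w measure \<Rightarrow> (real \<Rightarrow> 'w \<Rightarrow> real^'d) \<Rightarrow> (real^'d \<Rightarrow> real^'d) \<Rightarrow> (real^'d \<Rightarrow> real^'d^'d) \<Rightarrow>
   (real^'d) measure \<Rightarrow> bool" where
  "ergodic_diffusion M X drift diff \<mu> \<longleftrightarrow>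
     prob_space \<mu> \<and> sets \<mu> = sets borel \<and>
     (\<forall>(M' :: 'w measure) F' W' X'. sde_solution M' F' W' X' drift diff \<and> distr M' borel (X' 0) = \<mu>
        \<longrightarrow> (\<forall>t\<ge>0. distr M' borel (X' t) = \<mu>)) \<and>
     (\<forall>g :: real^'d \<Rightarrow> real. g \<in> borel_measurable borel \<and> bounded (range g) \<longrightarrow>
        conv_in_prob M (\<lambda>T \<omega>. (LINT s:{0..T}|lborel. g (X s \<omega>)) / T)
          (\<lambda>\<omega>. \<integral>x. g x \<partial>\<mu>) at_top)"


subsection \<open>Parameters, information matrix, rates\<close>

text \<open>A parameter \<open>\<theta> = (\<alpha>, \<beta>)\<close> is one vector indexed by the disjoint sum of the index types of
  \<open>\<alpha>\<close> and \<open>\<beta>\<close>, so that block matrices are ordinary matrices over that sum.\<close>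

definition drift_par :: "real^('p::finite + 'q::finite) \<Rightarrow> real^'p" where
  "drift_par \<theta> = (\<chi> j. \<theta> $ Inl j)"

definition diff_par :: "real^('p::finite + 'q::finite) \<Rightarrow> real^'q" where
  "diff_par \<theta> = (\<chi> k. \<theta> $ Inr k)"

definition param_space :: "(real^'p) set \<Rightarrow> (real^'q) set \<Rightarrow> (real^('p::finite + 'q::finite)) set" where
  "param_space Tp Tq = {\<theta>. drift_par \<theta> \<in> Tp \<and> diff_par \<theta> \<in> Tq}"

definition Sigma_mat :: "(real^'q \<Rightarrow> real^'d \<Rightarrow> real^'d^'d) \<Rightarrow> real^'q \<Rightarrow> real^'d \<Rightarrow> real^'d^'d" where
  "Sigma_mat \<sigma> \<beta> x = \<sigma> \<beta> x ** transpose (\<sigma> \<beta> x)"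

definition info_drift ::
  "(real^'p \<Rightarrow> real^'d \<Rightarrow> real^'d) \<Rightarrow> (real^'q \<Rightarrow> real^'d \<Rightarrow> real^'d^'d) \<Rightarrow> (real^'d) measure \<Rightarrow>
   real^('p::finite + 'q::finite) \<Rightarrow> 'p \<Rightarrow> 'p \<Rightarrow> real" where
  "info_drift b \<sigma> \<mu> \<theta> k j =
     (\<integral>x. partial k (\<lambda>\<alpha>. b \<alpha> x) (drift_par \<theta>) \<bullet>
        (matrix_inv (Sigma_mat \<sigma> (diff_par \<theta>) x) *v partial j (\<lambda>\<alpha>. b \<alpha> x) (drift_par \<theta>)) \<partial>\<mu>)"

definition info_diff ::
  "(real^'q \<Rightarrow> real^'d \<Rightarrow> real^'d^'d) \<Rightarrow> (real^'d) measure \<Rightarrow> 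
   real^('p::finite + 'q::finite) \<Rightarrow> 'q \<Rightarrow> 'q \<Rightarrow> real"
  where
  "info_diff \<sigma> \<mu> \<theta> k j =
     (1/2) * (\<integral>x. trace
        (matrix_inv (Sigma_mat \<sigma> (diff_par \<theta>) x) **
         partial k (\<lambda>\<beta>. Sigma_mat \<sigma> \<beta> x) (diff_par \<theta>) **
         matrix_inv (Sigma_mat \<sigma> (diff_par \<theta>) x) **
         partial j (\<lambda>\<beta>. Sigma_mat \<sigma> \<beta> x) (diff_par \<theta>)) \<partial>\<mu>)"

text \<open>Here \<open>\<mu>\<close> stands for the invariant law belonging to \<open>\<theta>\<close>.\<close>

definition info ::
  "(real^'p \<Rightarrow> real^'d \<Rightarrow> real^'d) \<Rightarrow> (real^'q \<Rightarrow> real^'d \<Rightarrow> real^'d^'d) \<Rightarrow> (real^'d) measure \<Rightarrow>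
   real^('p::finite + 'q::finite) \<Rightarrow> real^('p::finite + 'q::finite)^('p::finite + 'q::finite)" where
  "info b \<sigma> \<mu> \<theta> = (\<chi> i i'. case (i, i') of
       (Inl k, Inl j) \<Rightarrow> info_drift b \<sigma> \<mu> \<theta> k j
     | (Inr k, Inr j) \<Rightarrow> info_diff \<sigma> \<mu> \<theta> k j
     | _ \<Rightarrow> 0)"

definition rate :: "(nat \<Rightarrow> real) \<Rightarrow> nat \<Rightarrow> 'p + 'q \<Rightarrow> real" where
  "rate \<Delta> n i = (case i of Inl _ \<Rightarrow> 1 / (real n * \<Delta> n) | Inr _ \<Rightarrow> 1 / real n)"

definition phi_pow ::
  "real \<Rightarrow> (nat \<Rightarrow> real) \<Rightarrow> nat \<Rightarrow> real^('p::finite + 'q::finite)^('p::finite + 'q::finite)"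
  where
  "phi_pow r \<Delta> n = diag_mat (\<lambda>i. rate \<Delta> n i powr r)"

text \<open>Restriction of vectors and matrices to the coordinates enumerated by \<open>\<iota>\<close>.\<close>

definition sub_vec :: "('s \<Rightarrow> 'i) \<Rightarrow> real^'i \<Rightarrow> real^'s" where
  "sub_vec \<iota> v = (\<chi> s. v $ \<iota> s)"

definition sub_mat :: "('s \<Rightarrow> 'i) \<Rightarrow> real^'i^'i \<Rightarrow> real^'s^'s" where
  "sub_mat \<iota> A = (\<chi> s s'. A $ \<iota> s $ \<iota> s')"


subsection \<open>Observations and the penalised objective\<close>

text \<open>A sample of size \<open>n\<close> is an element of the product space over the index set \<open>{..n}\<close>.\<close>

definition sample ::
  "(real \<Rightarrow> 'w \<Rightarrow> real^'d) \<Rightarrow> (nat \<Rightarrow> real) \<Rightarrow> nat \<Rightarrow> 'w \<Rightarrow> (nat \<Rightarrow> real^'d)" where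
  "sample X \<Delta> n \<omega> = (\<lambda>i\<in>{..n}. X (real i * \<Delta> n) \<omega>)"

abbreviation sample_space :: "nat \<Rightarrow> (nat \<Rightarrow> real^'d) measure" where
  "sample_space n \<equiv> PiM {..n} (\<lambda>_. borel)"

definition lasso_objective ::
  "real^('p::finite + 'q::finite)^('p::finite + 'q::finite) \<Rightarrow> real^('p::finite + 'q::finite) \<Rightarrow> 
   ('p \<Rightarrow> real) \<Rightarrow> ('q \<Rightarrow> real) \<Rightarrow> real^('p::finite + 'q::finite) \<Rightarrow> real"
  where
  "lasso_objective A \<theta>t l g \<theta> =
     (\<theta> - \<theta>t) \<bullet> (A *v (\<theta> - \<theta>t)) +
     (\<Sum>j\<in>UNIV. l j * \<bar>drift_par \<theta> $ j\<bar>) + (\<Sum>k\<in>UNIV. g k * \<bar>diff_par \<theta> $ k\<bar>)"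

definition scaled_hessian ::
  "(nat \<Rightarrow> (nat \<Rightarrow> real^'d) \<Rightarrow> real^('p::finite + 'q::finite) \<Rightarrow> real) \<Rightarrow> (nat \<Rightarrow> real) \<Rightarrow> nat \<Rightarrow>
   (nat \<Rightarrow> real^'d) \<Rightarrow> real^('p::finite + 'q::finite) \<Rightarrow> 
   real^('p::finite + 'q::finite)^('p::finite + 'q::finite)" where
  "scaled_hessian H \<Delta> n x \<theta> =
     phi_pow (1/2) \<Delta> n ** hessian (H n x) \<theta> ** phi_pow (1/2) \<Delta> n"

text \<open>Convergence of the scaled Hessian at each fixed parameter value says nothing about its value
  at the random point \<open>\<theta>t n\<close> where the penalised objective uses it (that point may avoid every fixed
  value with probability one). The transfer is the following stochastic equicontinuity.\<close>

definition hessian_equicontinuous_along ::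
  "'w measure \<Rightarrow> (nat \<Rightarrow> 'w \<Rightarrow> nat \<Rightarrow> real^'d) \<Rightarrow>
   (nat \<Rightarrow> (nat \<Rightarrow> real^'d) \<Rightarrow> real^('p::finite + 'q::finite) \<Rightarrow> real) \<Rightarrow> (nat \<Rightarrow> real) \<Rightarrow>
   (nat \<Rightarrow> (nat \<Rightarrow> real^'d) \<Rightarrow> real^('p::finite + 'q::finite)) \<Rightarrow> real^('p::finite + 'q::finite) \<Rightarrow> bool" where
  "hessian_equicontinuous_along M S H \<Delta> \<theta>t \<theta> \<longleftrightarrow>
     conv_in_prob M
       (\<lambda>n \<omega>. scaled_hessian H \<Delta> n (S n \<omega>) (\<theta>t n (S n \<omega>)) - scaled_hessian H \<Delta> n (S n \<omega>) \<theta>)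
       (\<lambda>_. 0) sequentially"

end

theory Submission
  imports Defs
begin

text \<open>
  Rescale by \<open>u = \<phi>(n)\<^bsup>-1/2\<^esup>(\<theta> - \<theta>\<^sub>0)\<close> and let \<open>z\<close> be the rescaled error of the initial estimator,
  \<open>J\<close> the information matrix at \<open>\<theta>\<^sub>0\<close> and \<open>B\<close> its block of active coordinates. In the variable \<open>u\<close> the
  quadratic part of the objective is \<open>(u - z) A (u - z)'\<close> with \<open>A\<close> close to \<open>J\<close> in probability, the
  penalty on the active coordinates is negligible, and the penalty on the inactive ones has a slope
  that tends to infinity. Let \<open>w\<close> minimise \<open>(w - z) J (w - z)'\<close> among the vectors that vanish off the
  active coordinates; it is linear in \<open>z\<close>, with active part \<open>B\<^sup>-\<^sup>1(J z)\<close> restricted to the active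
  coordinates, and \<open>J(w - z)\<close> vanishes on the active coordinates. Comparing the objective at its
  minimiser \<open>u\<close> and at \<open>w\<close>, the cross term \<open>2 (u - w) J (w - z)'\<close> lives on the inactive coordinates,
  where the penalty absorbs it, so coercivity of \<open>J\<close> forces \<open>u - w\<close> to \<open>0\<close> in probability. By
  Slutsky's theorem the limit law is the image of \<open>N(0, J\<^sup>-\<^sup>1)\<close> under \<open>z \<mapsto> w\<close>. Gram-Schmidt for the inner
  product \<open>J\<close>, starting with the active coordinates, gives \<open>P\<close> with \<open>P' J P = I\<close> whose active columns are
  supported on the active coordinates; with \<open>z = P x\<close>, \<open>x\<close> standard normal, the active part of \<open>w\<close> is
  \<open>Q\<close> applied to the active coordinates of \<open>x\<close>, where \<open>Q' B Q = I\<close>, hence is \<open>N(0, B\<^sup>-\<^sup>1)\<close>.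
\<close>

subsection \<open>Gaussian laws under linear maps\<close>

lemma vimage_eq_image_of_inverse:
  assumes "\<And>x. f (g x) = x" "\<And>x. g (f x) = x"
  shows "g -` S = f ` S"
proof (intro subset_antisym subsetI)
  show "x \<in> f ` S" if "x \<in> g -` S" for x
    using that assms(1)[of x] by (metis imageI vimageD)
  show "x \<in> g -` S" if "x \<in> f ` S" for x
    using that assms(2) by auto
qed

text \<open>Closed boxes with \<open>0 \<le> a $ n\<close> keep their measure by
  \<open>measure_shear_interval\<close>, and a translation reduces every closed box to that case.
  Preimages under the inverse shear \<open>?g\<close> are images under \<open>?f\<close>, so the
  image of \<open>lborel\<close> under \<open>?g\<close> gives boxes their volume and is therefore
  \<open>lborel\<close>.\<close>

lemma emeasure_lborel_shear:
  fixes X :: "(real^'n) set"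
  assumes mn: "m \<noteq> n" and X: "X \<in> sets borel"
  shows "emeasure lborel ((\<lambda>x::real^'n. \<chi> i. if i = m then x$m + x$n else x$i) -` X) = emeasure lborel X"
proof -
  let ?f = "\<lambda>x::real^'n. \<chi> i. if i = m then x$m + x$n else x$i"
  let ?g = "\<lambda>x::real^'n. \<chi> i. if i = m then x$m - x$n else x$i"
  have lin: "linear ?f" "linear ?g"
    by (rule linearI; simp add: vec_eq_iff algebra_simps)+
  have fg: "?f (?g x) = x" "?g (?f x) = x" for x
    using mn by (auto simp: vec_eq_iff)
  have [measurable]: "?f \<in> borel_measurable borel" "?g \<in> borel_measurable borel"
    using lin by (auto intro!: borel_measurable_continuous_onI linear_continuous_on
        simp: linear_conv_bounded_linear)
  have pos: "emeasure lborel (?f ` cbox a b) = emeasure lborel (cbox a b)"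
    if ne: "cbox a b \<noteq> {}" and an: "0 \<le> a $ n" for a b
  proof -
    have c: "compact (?f ` cbox a b)"
      by (intro compact_continuous_image linear_continuous_on compact_cbox)
        (use lin in \<open>simp add: linear_conv_bounded_linear\<close>)
    then have b: "?f ` cbox a b \<in> sets borel"
      by (auto intro: borel_closed compact_imp_closed)
    have "emeasure lebesgue (?f ` cbox a b) = measure lebesgue (?f ` cbox a b)"
      using measurable_shear_interval[OF mn ne an] by (simp add: emeasure_eq_measure2)
    also have "\<dots> = measure lebesgue (cbox a b)"
      using measure_shear_interval[OF mn ne an] by simp
    also have "\<dots> = emeasure lebesgue (cbox a b)"
      by (simp add: emeasure_eq_measure2)
    finally show ?thesis
      using b by simp
  qed
  have box: "emeasure lborel (?f ` cbox a b) = emeasure lborel (cbox a b)" for a b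
  proof (cases "cbox a b = {}")
    case False
    \<comment> \<open>Translation by \<open>?v\<close> brings the lower corner to
      \<open>n\<close>-th coordinate 0; by linearity the shear turns it into translation by
      \<open>?f ?v\<close>.\<close>
    let ?v = "- (a $ n) *\<^sub>R axis n 1 :: real^'n"
    have eq: "?f ` cbox a b = (+) (- ?f ?v) ` ?f ` ((+) ?v ` cbox a b)"
      unfolding image_image by (rule image_cong) (auto simp: vec_eq_iff)
    have tr: "emeasure lborel ((+) v ` S) = emeasure lborel S" if "S \<in> sets borel" for v and S :: "(real^'n) set"
    proof -
      have "emeasure lborel S = emeasure (distr lborel borel ((+) (- v))) S"
        by (simp add: lborel_distr_plus)
      also have "\<dots> = emeasure lborel ((+) (- v) -` S)"
        using that by (simp add: emeasure_distr)
      also have "(+) (- v) -` S = (+) v ` S"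
        by (force simp: image_iff)
      finally show ?thesis by simp
    qed
    have c: "compact (?f ` (+) ?v ` cbox a b)"
      by (intro compact_continuous_image linear_continuous_on compact_translation compact_cbox)
        (use lin in \<open>simp add: linear_conv_bounded_linear\<close>)
    have "emeasure lborel (?f ` cbox a b) = emeasure lborel (?f ` ((+) ?v ` cbox a b))"
      unfolding eq using c by (intro tr) (auto intro: borel_closed compact_imp_closed)
    also have "(+) ?v ` cbox a b = cbox (?v + a) (?v + b)"
      by (rule cbox_translation[symmetric])
    also have "emeasure lborel (?f ` \<dots>) = emeasure lborel (cbox (?v + a) (?v + b))"
      using False by (intro pos) (simp_all add: cbox_translation del: uminus_add_conv_diff)
    also have "\<dots> = emeasure lborel (cbox a b)"
      unfolding cbox_translation by (rule tr) simp
    finally show ?thesis .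
  qed simp
  have "lborel = distr lborel borel ?g"
  proof (rule lborel_eqI)
    fix l u :: "real^'n" assume lu: "\<And>b. b \<in> Basis \<Longrightarrow> l \<bullet> b \<le> u \<bullet> b"
    have inv: "?g -` S = ?f ` S" for S
      by (rule vimage_eq_image_of_inverse[OF fg])
    \<comment> \<open>\<open>lborel_eqI\<close> tests open boxes while \<open>box\<close> treats
      closed ones. The faces are negligible and stay so under a linear map.\<close>
    have neg: "negligible (?f ` (cbox l u - box l u))"
      by (intro negligible_differentiable_image_negligible negligible_frontier_interval
          linear_imp_differentiable_on lin) simp
    have m: "?f ` box l u \<in> sets borel" "?f ` cbox l u \<in> sets borel"
      unfolding inv[symmetric] by (rule measurable_sets_borel[where M = borel]; simp)+
    have "emeasure lborel (?f ` cbox l u) = emeasure lborel (?f ` box l u)"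
    proof (rule emeasure_eq_AE)
      have "AE x in lebesgue. x \<notin> ?f ` (cbox l u - box l u)"
        using neg by (auto simp: negligible_iff_null_sets intro: AE_not_in)
      then have "AE x in lborel. x \<notin> ?f ` (cbox l u - box l u)"
        by (simp add: AE_completion_iff)
      then show "AE x in lborel. x \<in> ?f ` cbox l u \<longleftrightarrow> x \<in> ?f ` box l u"
        by eventually_elim (use box_subset_cbox[of l u] in blast)
    qed (use m in simp_all)
    then have "emeasure (distr lborel borel ?g) (box l u) = emeasure lborel (cbox l u)"
      by (simp add: emeasure_distr inv box)
    also have "\<dots> = (\<Prod>b\<in>Basis. (u - l) \<bullet> b)"
      using lu by (simp add: emeasure_lborel_cbox)
    finally show "emeasure (distr lborel borel ?g) (box l u) = (\<Prod>b\<in>Basis. (u - l) \<bullet> b)" .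
  qed simp
  then have "emeasure lborel (?f -` X) = emeasure (distr lborel borel ?g) (?f -` X)"
    by simp
  also have "\<dots> = emeasure lborel (?g -` ?f -` X)"
    using X by (subst emeasure_distr) (auto intro!: measurable_sets_borel[where M = borel])
  also have "?g -` ?f -` X = X"
    using fg by auto
  finally show ?thesis .
qed

text \<open>The library's change of variables for linear maps needs a well-ordered index type, which a
  sum type such as \<open>'p + 'q\<close> is not.\<close>

lemma emeasure_lborel_matrix_vimage:
  fixes A :: "real^'n^'n"
  assumes "det A \<noteq> 0" and "X \<in> sets borel"
  shows "emeasure lborel X = ennreal \<bar>det A\<bar> * emeasure lborel ((*v) A -` X)"
proof -
  \<comment> \<open>The set is quantified inside the induction because the product case uses the
    hypothesis for \<open>A\<close> at \<open>X\<close> and the one for \<open>B\<close> at the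
    preimage of \<open>X\<close> under \<open>A\<close>.\<close>
  have "det A \<noteq> 0 \<longrightarrow> (\<forall>X\<in>sets borel. emeasure lborel X = ennreal \<bar>det A\<bar> * emeasure lborel ((*v) A -` X))"
  proof (induction A rule: induct_matrix_elementary_alt)
    case (1 A B)
    show ?case
    proof (intro impI ballI)
      fix X :: "(real^'n) set"
      assume d: "det (A ** B) \<noteq> 0" and X: "X \<in> sets borel"
      then have ab: "det A \<noteq> 0" "det B \<noteq> 0"
        by (auto simp: det_mul)
      have AX: "(*v) A -` X \<in> sets borel"
        using X by (intro measurable_sets_borel) (auto intro!: borel_measurable_continuous_onI matrix_vector_mult_linear_continuous_on)
      have "emeasure lborel X = ennreal \<bar>det A\<bar> * (ennreal \<bar>det B\<bar> * emeasure lborel ((*v) B -` (*v) A -` X))"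
        using 1 ab X AX by metis
      also have "(*v) B -` (*v) A -` X = (*v) (A ** B) -` X"
        by (auto simp: matrix_vector_mul_assoc)
      finally show "emeasure lborel X = ennreal \<bar>det (A ** B)\<bar> * emeasure lborel ((*v) (A ** B) -` X)"
        by (simp add: det_mul abs_mult ennreal_mult mult.assoc)
    qed
  next
    case (2 A i)
    then show ?case by (metis det_zero_row(2))
  next
    case (3 A)
    show ?case
    proof (intro impI ballI)
      fix X :: "(real^'n) set"
      assume d: "det A \<noteq> 0" and X: "X \<in> sets borel"
      have det: "det A = (\<Prod>i\<in>UNIV. A $ i $ i)"
        using 3 by (rule det_diagonal)
      \<comment> \<open>\<open>lborel_affine_euclidean\<close> wants the scaling factors indexed by
        basis vectors; this sum returns \<open>A $ i $ i\<close> at \<open>axis i 1\<close>.\<close>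
      define c where "c = (\<lambda>b::real^'n. \<Sum>i\<in>UNIV. b $ i * A $ i $ i)"
      have c: "c (axis i 1) = A $ i $ i" for i
        by (simp add: c_def axis_def if_distrib[of "\<lambda>x. x * _"] cong: if_cong)
      have Bas: "(Basis :: (real^'n) set) = range (\<lambda>i. axis i 1)"
        by (auto simp: Basis_vec_def)
      have inj: "inj (\<lambda>i::'n. axis i (1::real))"
        by (auto simp: inj_def axis_eq_axis)
      have T: "(0 :: real^'n) + (\<Sum>j\<in>Basis. (c j * (x \<bullet> j)) *\<^sub>R j) = A *v x" for x
      proof -
        have "(\<Sum>j\<in>Basis. (c j * (x \<bullet> j)) *\<^sub>R j) $ k = (A *v x) $ k" for k
        proof -
          have "(\<Sum>j\<in>Basis. (c j * (x \<bullet> j)) *\<^sub>R j) $ k = (\<Sum>i\<in>UNIV. A $ i $ i * x $ i * (axis i 1 $ k))"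
            unfolding Bas by (simp add: sum.reindex[OF inj] c inner_axis)
          also have "\<dots> = A $ k $ k * x $ k"
            by (simp add: axis_def if_distrib[of "\<lambda>x. _ * x"] cong: if_cong)
          also have "\<dots> = (\<Sum>j\<in>UNIV. A $ k $ j * x $ j)"
            using 3 by (subst sum.remove[of _ k]) (auto intro!: sum.neutral)
          finally show ?thesis by (simp add: matrix_vector_mult_def)
        qed
        then show ?thesis by (simp add: vec_eq_iff)
      qed
      have P: "(\<Prod>j\<in>Basis. \<bar>c j\<bar>) = \<bar>det A\<bar>"
        unfolding Bas det by (simp add: prod.reindex[OF inj] c abs_prod)
      have "lborel = density (distr lborel borel (\<lambda>x. 0 + (\<Sum>j\<in>Basis. (c j * (x \<bullet> j)) *\<^sub>R j))) (\<lambda>_. (\<Prod>j\<in>Basis. \<bar>c j\<bar>))"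
        using d by (intro lborel_affine_euclidean) (auto simp: Bas c det)
      then have "lborel = density (distr lborel borel ((*v) A)) (\<lambda>_. \<bar>det A\<bar>)"
        unfolding T P .
      then have "emeasure lborel X = emeasure (density (distr lborel borel ((*v) A)) (\<lambda>_. \<bar>det A\<bar>)) X"
        by simp
      also have "\<dots> = ennreal \<bar>det A\<bar> * emeasure lborel ((*v) A -` X)"
      proof -
        have "(*v) A \<in> borel_measurable borel"
          by (auto intro!: borel_measurable_continuous_onI matrix_vector_mult_linear_continuous_on)
        then show ?thesis
          using X by (simp add: emeasure_density nn_integral_cmult emeasure_distr)
      qed
      finally show "emeasure lborel X = ennreal \<bar>det A\<bar> * emeasure lborel ((*v) A -` X)" .
    qed
  next
    case (4 m n)
    let ?A = "\<chi> i j. mat 1 $ i $ Transposition.transpose m n j :: real^'n^'n"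
    let ?t = "Transposition.transpose m n"
    have tt: "i = ?t j \<longleftrightarrow> j = ?t i" for i j
      using transpose_involutory[of m n i] transpose_involutory[of m n j] by auto
    have ev: "?A *v x = (\<chi> i. x $ ?t i)" for x
    proof -
      have "(?A *v x) $ i = x $ ?t i" for i
      proof -
        have "(?A *v x) $ i = (\<Sum>j\<in>UNIV. if j = ?t i then x $ j else 0)"
          unfolding matrix_vector_mult_def mat_def vec_lambda_beta
          by (rule sum.cong) (use tt in auto)
        then show ?thesis by simp
      qed
      then show ?thesis by (simp add: vec_eq_iff)
    qed
    have M: "(*v) ?A \<in> borel_measurable borel"
      by (auto intro!: borel_measurable_continuous_onI matrix_vector_mult_linear_continuous_on)
    have "det ?A = of_int (sign ?t) * det (mat 1 :: real^'n^'n)"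
      by (rule det_permute_columns) (simp add: permutes_swap_id)
    then have det: "\<bar>det ?A\<bar> = 1"
      using 4 by (simp add: sign_swap_id)
    \<comment> \<open>Swapping two coordinates carries a box to the box with swapped endpoints,
      whose side lengths have the same product.\<close>
    have "lborel = distr lborel borel ((*v) ?A)"
    proof (rule lborel_eqI)
      fix l u :: "real^'n" assume lu: "\<And>b. b \<in> Basis \<Longrightarrow> l \<bullet> b \<le> u \<bullet> b"
      have v: "(*v) ?A -` box l u = box (\<chi> i. l $ ?t i) (\<chi> i. u $ ?t i)"
        proof -
        have "(\<forall>i. l $ i < x $ ?t i \<and> x $ ?t i < u $ i) \<longleftrightarrow> (\<forall>i. l $ ?t i < x $ i \<and> x $ i < u $ ?t i)" for x :: "real^'n"
          using transpose_involutory[of m n] by metis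
        then show ?thesis
          unfolding ev by (auto simp: mem_box_cart)
      qed
      have Bas: "(Basis :: (real^'n) set) = range (\<lambda>i. axis i 1)"
        by (auto simp: Basis_vec_def)
      have inj: "inj (\<lambda>i::'n. axis i (1::real))"
        by (auto simp: inj_def axis_eq_axis)
      have le: "l $ i \<le> u $ i" for i
        using lu[of "axis i 1"] by (simp add: Bas inner_axis)
      have "(\<Prod>i\<in>UNIV. u $ ?t i - l $ ?t i) = (\<Prod>i\<in>UNIV. u $ i - l $ i)"
        by (rule prod.reindex_bij_betw) (simp add: bij_betw_def)
      then show "emeasure (distr lborel borel ((*v) ?A)) (box l u) = (\<Prod>b\<in>Basis. (u - l) \<bullet> b)"
        using le M by (simp add: emeasure_distr v emeasure_lborel_box_eq Bas prod.reindex[OF inj] inner_axis)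
    qed simp
    then have "emeasure lborel X = emeasure lborel ((*v) ?A -` X)" if "X \<in> sets borel" for X
      using that M emeasure_distr[of "(*v) ?A" lborel borel X] by simp
    then show ?case
      using det by simp
  next
    case (5 m n)
    let ?A = "\<chi> i j. of_bool (i = m \<and> j = n \<or> i = j) :: real^'n^'n"
    have ev: "(*v) ?A = (\<lambda>x. \<chi> i. if i = m then x$m + x$n else x$i)"
    proof (rule ext)
      fix x :: "real^'n"
      have "(?A *v x) $ i = (if i = m then x$m + x$n else x$i)" for i
      proof -
        have "(?A *v x) $ i = (\<Sum>j\<in>UNIV. (if j = i then x $ j else 0) + (if i = m \<and> j = n then x $ j else 0))"
          using 5 by (auto simp: matrix_vector_mult_def intro!: sum.cong)
        also have "\<dots> = x $ i + (if i = m then x $ n else 0)"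
          by (simp add: sum.distrib)
        finally show ?thesis by simp
      qed
      then show "?A *v x = (\<chi> i. if i = m then x$m + x$n else x$i)"
        by (simp add: vec_eq_iff)
    qed
    \<comment> \<open>The shear matrix is the identity with row \<open>n\<close> added to row
      \<open>m\<close>, so its determinant is 1.\<close>
    have "det (\<chi> k. if k = m then row m (mat 1 :: real^'n^'n) + 1 *s row n (mat 1) else row k (mat 1)) = det (mat 1 :: real^'n^'n)"
      using 5 by (rule det_row_operation)
    also have "(\<chi> k. if k = m then row m (mat 1 :: real^'n^'n) + 1 *s row n (mat 1) else row k (mat 1)) = ?A"
      using 5 by (auto simp: vec_eq_iff row_def mat_def)
    finally have "det ?A = 1" by simp
    then show ?case
      unfolding ev using emeasure_lborel_shear[OF 5] by simp
  qed
  then show ?thesis using assms by blast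
qed

lemma borel_measurable_matrix_vector_mult [measurable]:
  fixes A :: "real^'n^'m"
  shows "(*v) A \<in> borel_measurable borel"
  by (auto intro!: borel_measurable_continuous_onI matrix_vector_mult_linear_continuous_on)

lemma borel_measurable_sub_vec [measurable]: "sub_vec \<iota> \<in> borel_measurable borel"
  unfolding sub_vec_def
  by (intro borel_measurable_continuous_onI continuous_intros)

text \<open>\<open>matrix_inv\<close> is a choice among two-sided inverses. For square matrices the
  one-sided inverse \<open>B\<close> is two-sided, and cancelling \<open>A\<close> on the left
  identifies the chosen inverse with \<open>B\<close>.\<close>

lemma matrix_inv_eqI:
  fixes A :: "real^'n^'n"
  assumes "A ** B = mat 1"
  shows "matrix_inv A = B"
proof -
  have BA: "B ** A = mat 1" using assms by (simp add: matrix_left_right_inverse)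
  have "A ** matrix_inv A = mat 1 \<and> matrix_inv A ** A = mat 1"
    unfolding matrix_inv_def
    by (rule someI[of "\<lambda>X. A ** X = mat 1 \<and> X ** A = mat 1" B]) (simp add: assms BA)
  then have "B ** (A ** matrix_inv A) = B" by simp
  then show ?thesis
    by (simp add: matrix_mul_assoc BA)
qed

lemma nn_integral_lborel_matrix:
  fixes P :: "real^'n^'n"
  assumes "det P \<noteq> 0" and [measurable]: "g \<in> borel_measurable borel"
  shows "(\<integral>\<^sup>+x. g x \<partial>lborel) = ennreal \<bar>det P\<bar> * (\<integral>\<^sup>+x. g (P *v x) \<partial>lborel)"
proof -
  have "lborel = density (distr lborel borel ((*v) P)) (\<lambda>_. ennreal \<bar>det P\<bar>)" (is "_ = ?D")
  proof (rule measure_eqI)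
    fix X :: "(real^'n) set" assume "X \<in> sets lborel"
    then show "emeasure lborel X = emeasure ?D X"
      using assms(1) emeasure_lborel_matrix_vimage[of P X]
      by (simp add: emeasure_density nn_integral_cmult emeasure_distr)
  qed simp
  then have "(\<integral>\<^sup>+x. g x \<partial>lborel) = (\<integral>\<^sup>+x. g x \<partial>?D)"
    by simp
  also have "\<dots> = ennreal \<bar>det P\<bar> * (\<integral>\<^sup>+x. g (P *v x) \<partial>lborel)"
    by (simp add: nn_integral_density nn_integral_cmult nn_integral_distr)
  finally show ?thesis .
qed

section \<open>Normal laws: linear images and coordinate projections\<close>

lemma sets_multi_normal [simp, measurable_cong]: "sets (multi_normal m C) = sets borel"
  by (simp add: multi_normal_def)

lemma space_multi_normal [simp]: "space (multi_normal m C) = UNIV"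
  by (simp add: multi_normal_def)

text \<open>Such a \<open>P\<close> replaces an inverse square root of \<open>B\<close>. In the
  square case the left inverse \<open>transpose P\<close> of \<open>B ** P\<close> is also a right
  inverse, which exhibits the inverse of \<open>B\<close> as
  \<open>P ** transpose P\<close>.\<close>

lemma congruence_to_mat_1:
  fixes P B :: "real^'n^'n"
  assumes P: "transpose P ** B ** P = mat 1"
  shows "matrix_inv B = P ** transpose P" "matrix_inv (matrix_inv B) = B" "det P \<noteq> 0"
    "B ** matrix_inv B = mat 1"
proof -
  have "transpose P ** (B ** P) = mat 1"
    using P by (simp add: matrix_mul_assoc)
  then have "(B ** P) ** transpose P = mat 1"
    by (simp add: matrix_left_right_inverse)
  then have 1: "B ** (P ** transpose P) = mat 1"
    by (simp add: matrix_mul_assoc)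
  then show 2: "matrix_inv B = P ** transpose P"
    by (rule matrix_inv_eqI)
  show "B ** matrix_inv B = mat 1"
    unfolding 2 by (rule 1)
  show "matrix_inv (matrix_inv B) = B"
    unfolding 2 by (rule matrix_inv_eqI) (use 1 matrix_left_right_inverse in blast)
  have "det (transpose P ** B ** P) = 1"
    unfolding P by simp
  then show "det P \<noteq> 0"
    by (auto simp: det_mul)
qed

lemma multi_normal_std:
  "multi_normal 0 (mat 1 :: real^'n^'n) =
     density lborel (\<lambda>x. ennreal (exp (- (x \<bullet> x) / 2) / sqrt ((2 * pi) ^ CARD('n))))"
proof -
  have "matrix_inv (mat 1 :: real^'n^'n) = mat 1"
    by (rule matrix_inv_eqI) simp
  then show ?thesis
    by (simp add: multi_normal_def)
qed

text \<open>The substitution of \<open>P *v x\<close> turns the quadratic form of \<open>B\<close>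
  into \<open>x \<bullet> x\<close>. The covariance has determinant \<open>(det P)\<^sup>2\<close>,
  so the normalising constant contains \<open>\<bar>det P\<bar>\<close>, which the Jacobian
  cancels.\<close>

lemma multi_normal_eq_distr_std:
  fixes P B :: "real^'n^'n"
  assumes P: "transpose P ** B ** P = mat 1"
  shows "multi_normal 0 (matrix_inv B) = distr (multi_normal 0 (mat 1)) borel ((*v) P)"
proof (rule measure_eqI)
  fix X :: "(real^'n) set" assume "X \<in> sets (multi_normal 0 (matrix_inv B))"
  then have [measurable]: "X \<in> sets borel" by simp
  note c = congruence_to_mat_1[OF P]
  define K where "K = sqrt ((2 * pi) ^ CARD('n))"
  define g where "g = (\<lambda>x::real^'n. ennreal (exp (- (x \<bullet> (B *v x)) / 2) / (K * \<bar>det P\<bar>)))"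
  have K: "K > 0" by (simp add: K_def)
  have "det (matrix_inv B) = (det P)\<^sup>2"
    by (simp add: c(1) det_mul power2_eq_square)
  then have mn: "multi_normal 0 (matrix_inv B) = density lborel g"
    by (simp add: multi_normal_def c(2) g_def K_def real_sqrt_mult)
  have quad: "(P *v x) \<bullet> (B *v (P *v x)) = x \<bullet> x" for x
  proof -
    have "(P *v x) \<bullet> (B *v (P *v x)) = (transpose P *v (B *v (P *v x))) \<bullet> x"
      by (metis dot_lmul_matrix inner_commute transpose_matrix_vector transpose_transpose)
    also have "\<dots> = x \<bullet> x"
      using P by (simp add: matrix_vector_mul_assoc matrix_mul_assoc)
    finally show ?thesis .
  qed
  have [measurable]: "g \<in> borel_measurable borel"
    unfolding g_def by measurable
  have gP: "ennreal \<bar>det P\<bar> * g (P *v x) = ennreal (exp (- (x \<bullet> x) / 2) / K)" for x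
    unfolding g_def using c(3) K by (simp add: ennreal_mult'[symmetric] quad)
  have "emeasure (density lborel g) X = (\<integral>\<^sup>+x. g x * indicator X x \<partial>lborel)"
    by (simp add: emeasure_density)
  also have "\<dots> = ennreal \<bar>det P\<bar> * (\<integral>\<^sup>+x. g (P *v x) * indicator X (P *v x) \<partial>lborel)"
    using c(3) by (intro nn_integral_lborel_matrix) auto
  also have "\<dots> = (\<integral>\<^sup>+x. ennreal \<bar>det P\<bar> * (g (P *v x) * indicator X (P *v x)) \<partial>lborel)"
    by (rule nn_integral_cmult[symmetric]) simp
  also have "\<dots> = (\<integral>\<^sup>+x. ennreal (exp (- (x \<bullet> x) / 2) / K) * indicator ((*v) P -` X) x \<partial>lborel)"
    by (simp add: mult.assoc[symmetric] gP indicator_vimage[symmetric] o_def)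
  also have "\<dots> = emeasure (distr (multi_normal 0 (mat 1)) borel ((*v) P)) X"
    by (simp add: emeasure_distr multi_normal_std emeasure_density K_def measurable_sets_borel[where M = borel])
  finally show "emeasure (multi_normal 0 (matrix_inv B)) X = emeasure (distr (multi_normal 0 (mat 1)) borel ((*v) P)) X"
    by (simp add: mn)
qed simp

text \<open>The standard normal density is a product over coordinates. Each coordinate outside
  \<open>range \<iota>\<close> carries no constraint and integrates to 1; injectivity of
  \<open>\<iota>\<close> reindexes the rest.\<close>

lemma emeasure_sub_vec_std_normal_box:
  fixes \<iota> :: "'s::finite \<Rightarrow> 'i::finite"
  assumes \<iota>: "inj \<iota>"
  shows "emeasure (distr (multi_normal 0 (mat 1)) borel (sub_vec \<iota>)) (box l u) =
    (\<Prod>s\<in>UNIV. \<integral>\<^sup>+x. ennreal (std_normal_density x) * indicator {l$s<..<u$s} x \<partial>lborel)"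
proof -
  define h :: "'i \<Rightarrow> real \<Rightarrow> ennreal" where
    "h i x = ennreal (std_normal_density x) *
       (if i \<in> range \<iota> then indicator {l $ inv \<iota> i<..<u $ inv \<iota> i} x else 1)" for i x
  have [measurable]: "h i \<in> borel_measurable borel" for i
    unfolding h_def by (cases "i \<in> range \<iota>") simp_all
  have Bas: "(Basis :: (real^'i) set) = range (\<lambda>i. axis i 1)"
    by (auto simp: Basis_vec_def)
  have inj: "inj (\<lambda>i::'i. axis i (1::real))"
    by (auto simp: inj_def axis_eq_axis)
  \<comment> \<open>The product rule for \<open>lborel\<close> runs over basis vectors;
    \<open>ix\<close> recovers the coordinate from its basis vector.\<close>
  define ix where "ix = the_inv (\<lambda>i::'i. axis i (1::real))"
  have ix: "ix (axis i 1) = i" for i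
    unfolding ix_def by (rule the_inv_f_f[OF inj])
  have ind: "(\<Prod>i\<in>UNIV. if i \<in> range \<iota> then indicator {l $ inv \<iota> i<..<u $ inv \<iota> i} (x $ i) else 1)
      = (indicator (sub_vec \<iota> -` box l u) x :: ennreal)" for x :: "real^'i"
  proof -
    have "(\<Prod>i\<in>UNIV. if i \<in> range \<iota> then indicator {l $ inv \<iota> i<..<u $ inv \<iota> i} (x $ i) else (1::ennreal))
      = (\<Prod>i\<in>range \<iota>. indicator {l $ inv \<iota> i<..<u $ inv \<iota> i} (x $ i))"
      by (intro prod.mono_neutral_cong_right) auto
    also have "\<dots> = (\<Prod>s\<in>UNIV. indicator {l $ s<..<u $ s} (x $ \<iota> s))"
      by (simp add: prod.reindex[OF \<iota>] inv_f_f[OF \<iota>])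
    also have "\<dots> = indicator (sub_vec \<iota> -` box l u) x"
      by (auto simp: indicator_def mem_box_cart sub_vec_def)
    finally show ?thesis .
  qed
  have dens: "ennreal (exp (- (x \<bullet> x) / 2) / sqrt ((2 * pi) ^ CARD('i))) = (\<Prod>i\<in>UNIV. ennreal (std_normal_density (x $ i)))"
    for x :: "real^'i"
    by (simp add: prod_ennreal std_normal_density_def prod.distrib exp_sum[symmetric] inner_vec_def
        power2_eq_square sum_negf sum_divide_distrib real_sqrt_power prod_dividef field_simps)
      (simp add: real_sqrt_mult real_sqrt_power power_mult_distrib)
  have one: "(\<integral>\<^sup>+x. ennreal (std_normal_density x) \<partial>lborel) = 1"
    using prob_space.emeasure_space_1[OF prob_space_normal_density[of 1 0]] by (simp add: emeasure_density)
  have "emeasure (distr (multi_normal 0 (mat 1)) borel (sub_vec \<iota>)) (box l u) =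
      (\<integral>\<^sup>+x. (\<Prod>i\<in>UNIV. h i (x $ i)) \<partial>lborel)"
    unfolding h_def prod.distrib dens[symmetric] ind
    by (simp add: emeasure_distr multi_normal_std emeasure_density measurable_sets_borel[where M = borel])
  also have "\<dots> = (\<integral>\<^sup>+x. (\<Prod>b\<in>Basis. h (ix b) (x \<bullet> b)) \<partial>lborel)"
    by (simp add: Bas prod.reindex[OF inj] ix inner_axis)
  also have "\<dots> = (\<Prod>b\<in>(Basis :: (real^'i) set). \<integral>\<^sup>+x. h (ix b) x \<partial>lborel)"
    by (rule nn_integral_lborel_prod) auto
  also have "\<dots> = (\<Prod>i\<in>UNIV. \<integral>\<^sup>+x. h i x \<partial>lborel)"
    by (simp add: Bas prod.reindex[OF inj] ix)
  also have "\<dots> = (\<Prod>i\<in>range \<iota>. \<integral>\<^sup>+x. h i x \<partial>lborel)"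
    by (rule prod.mono_neutral_right) (auto simp: h_def one)
  also have "\<dots> = (\<Prod>s\<in>UNIV. \<integral>\<^sup>+x. ennreal (std_normal_density x) * indicator {l$s<..<u$s} x \<partial>lborel)"
    by (simp add: prod.reindex[OF \<iota>] h_def inv_f_f[OF \<iota>])
  finally show ?thesis .
qed

text \<open>Open boxes form an intersection-stable generator, and countably many of them, all of
  finite mass, exhaust the space; so agreement on boxes suffices.\<close>

lemma distr_sub_vec_std_normal:
  fixes \<iota> :: "'s::finite \<Rightarrow> 'i::finite"
  assumes \<iota>: "inj \<iota>"
  shows "distr (multi_normal 0 (mat 1)) borel (sub_vec \<iota>) = multi_normal 0 (mat 1)"
proof -
  let ?E = "range (\<lambda>(a, b). box a b::(real^'s) set)"
  let ?A = "\<lambda>n::nat. box (- (real n *\<^sub>R One)) (real n *\<^sub>R One) :: (real^'s) set"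
  let ?M = "distr (multi_normal 0 (mat 1)) borel (sub_vec \<iota>)"
  \<comment> \<open>Writing the target law as a projection along \<open>id\<close> lets the same box
    formula evaluate both sides.\<close>
  have id: "multi_normal 0 (mat 1 :: real^'s^'s) = distr (multi_normal 0 (mat 1)) borel (sub_vec id)"
    by (rule measure_eqI) (simp_all add: emeasure_distr sub_vec_def[abs_def])
  have one: "(\<integral>\<^sup>+x. ennreal (std_normal_density x) \<partial>lborel) = 1"
    using prob_space.emeasure_space_1[OF prob_space_normal_density[of 1 0]] by (simp add: emeasure_density)
  have fin: "emeasure ?M (box l u) \<noteq> \<infinity>" for l u
  proof -
    have "(\<integral>\<^sup>+x. ennreal (std_normal_density x) * indicator S x \<partial>lborel) \<le> 1" for S :: "real set"
      unfolding one[symmetric] by (intro nn_integral_mono) (auto simp: indicator_def)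
    then have "emeasure ?M (box l u) \<le> 1"
      unfolding emeasure_sub_vec_std_normal_box[OF \<iota>] by (intro prod_le_1) auto
    then show ?thesis
      by (auto simp: top_unique)
  qed
  show ?thesis
  proof (rule measure_eqI_generator_eq)
    show "Int_stable ?E"
      by (auto simp: Int_stable_def box_Int_box)
    show "?E \<subseteq> Pow UNIV" "sets ?M = sigma_sets UNIV ?E"
        "sets (multi_normal 0 (mat 1 :: real^'s^'s)) = sigma_sets UNIV ?E"
      by (simp_all add: borel_eq_box)
    show "range ?A \<subseteq> ?E" "(\<Union>i. ?A i) = UNIV"
      unfolding UN_box_eq_UNIV by auto
    show "emeasure ?M (?A i) \<noteq> \<infinity>" for i
      by (rule fin)
    show "emeasure ?M Y = emeasure (multi_normal 0 (mat 1)) Y" if "Y \<in> ?E" for Y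
      using that by (subst id) (auto simp: emeasure_sub_vec_std_normal_box \<iota>)
  qed
qed

section \<open>Gram-Schmidt for a positive definite form\<close>

lemma inner_matrix_symmetric:
  fixes J :: "real^'n^'n"
  assumes "transpose J = J"
  shows "x \<bullet> (J *v y) = (J *v x) \<bullet> y"
  using assms by (metis dot_lmul_matrix transpose_matrix_vector)

text \<open>Indices are added one at a time: from \<open>axis k 1\<close> its
  \<open>J\<close>-projection on the earlier vectors is subtracted, and the result is normalised.
  Because the vectors on \<open>D\<close> are left untouched, a second extension preserves the
  support obtained in the first.\<close>

lemma gram_schmidt_extend:
  fixes J :: "real^'n^'n" and p :: "'n \<Rightarrow> real^'n"
  assumes J: "pos_definite J"
  defines "good \<equiv> \<lambda>D p. \<forall>i\<in>D. (\<forall>k. k \<notin> D \<longrightarrow> p i $ k = 0) \<and>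
      (\<forall>j\<in>D. p i \<bullet> (J *v p j) = (if i = j then 1 else 0))"
  assumes p: "good D p"
  shows "\<exists>q. good (D \<union> F) q \<and> (\<forall>i\<in>D. q i = p i)"
proof -
  have sym: "transpose J = J" and pos: "v \<noteq> 0 \<Longrightarrow> 0 < v \<bullet> (J *v v)" for v
    using J by (auto simp: pos_definite_def)
  have "finite F" by simp
  then show ?thesis
  proof induction
    case empty
    then show ?case using p by auto
  next
    case (insert k F)
    then obtain q where q: "good (D \<union> F) q" and qp: "\<forall>i\<in>D. q i = p i" by blast
    show ?case
    proof (cases "k \<in> D")
      case True
      then show ?thesis using q qp by (auto simp: insert_absorb)
    next
      case False
      define E where "E = D \<union> F"
      have kE: "k \<notin> E" using False insert by (auto simp: E_def)
      have sup: "q i $ m = 0" if "i \<in> E" "m \<notin> E" for i m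
        using q that by (auto simp: good_def E_def)
      have orth: "q i \<bullet> (J *v q j) = (if i = j then 1 else 0)" if "i \<in> E" "j \<in> E" for i j
        using q that unfolding good_def E_def by blast
      define c where "c i = axis k 1 \<bullet> (J *v q i)" for i
      define v where "v = axis k 1 - (\<Sum>i\<in>E. c i *\<^sub>R q i)"
      define w where "w = (1 / sqrt (v \<bullet> (J *v v))) *\<^sub>R v"
      \<comment> \<open>The earlier vectors are supported on \<open>E\<close>, which does not
        contain \<open>k\<close>. Hence \<open>v\<close> is nonzero and can be normalised.\<close>
      have "v $ k = 1"
        using kE sup by (simp add: v_def)
      then have "v \<noteq> 0" by auto
      then have vv: "0 < v \<bullet> (J *v v)" by (rule pos)
      have ww: "w \<bullet> (J *v w) = 1"
        using vv by (simp add: w_def matrix_vector_mult_scaleR real_sqrt_mult_self flip: power2_eq_square)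
      have wq: "w \<bullet> (J *v q j) = 0" if "j \<in> E" for j
      proof -
        have "v \<bullet> (J *v q j) = c j - (\<Sum>i\<in>E. c i * (q i \<bullet> (J *v q j)))"
          by (simp add: v_def inner_diff_left inner_sum_left c_def)
        also have "(\<Sum>i\<in>E. c i * (q i \<bullet> (J *v q j))) = (\<Sum>i\<in>E. if i = j then c i else 0)"
          using that by (intro sum.cong) (auto simp: orth)
        finally show ?thesis
          using that by (simp add: w_def)
      qed
      have qw: "q j \<bullet> (J *v w) = 0" if "j \<in> E" for j
        using wq[OF that] inner_matrix_symmetric[OF sym, of w "q j"] by (simp add: inner_commute)
      have wsup: "w $ m = 0" if "m \<notin> insert k E" for m
        using that sup by (simp add: w_def v_def axis_def)
      have "good (insert k E) (q(k := w))"
        unfolding good_def using kE sup orth ww wq qw wsup by auto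
      then have "good (D \<union> insert k F) (q(k := w))"
        by (simp only: E_def Un_insert_right)
      moreover have "\<forall>i\<in>D. (q(k := w)) i = p i"
        using qp False by auto
      ultimately show ?thesis by blast
    qed
  qed
qed

text \<open>Two extensions give the block triangular shape: the first builds vectors on
  \<open>A\<close>, supported there, and the second completes them to all indices. They become the
  columns of \<open>P\<close>.\<close>

lemma pos_definite_congruence:
  fixes J :: "real^'n^'n"
  assumes J: "pos_definite J"
  obtains P where "transpose P ** J ** P = mat 1" "\<And>i a. a \<in> A \<Longrightarrow> i \<notin> A \<Longrightarrow> P $ i $ a = 0"
proof -
  \<comment> \<open>Over the empty index set every family qualifies vacuously, so the start is
    \<open>undefined\<close>.\<close>
  obtain p where p: "\<forall>i\<in>A. (\<forall>k. k \<notin> A \<longrightarrow> p i $ k = 0) \<and>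
      (\<forall>j\<in>A. p i \<bullet> (J *v p j) = (if i = j then 1 else 0))"
    using gram_schmidt_extend[OF J, of "{}" undefined A] by auto
  obtain q where q: "\<forall>i j. q i \<bullet> (J *v q j) = (if i = j then 1 else 0)" and qp: "\<forall>i\<in>A. q i = p i"
    using gram_schmidt_extend[OF J p, of UNIV] by auto
  define P where "P = transpose (vec_lambda q)"
  have "(transpose P ** J ** P) $ i $ j = q i \<bullet> (J *v q j)" for i j
  proof -
    have "(transpose P ** J ** P) $ i $ j = (transpose P ** (J ** P)) $ i $ j"
      by (simp add: matrix_mul_assoc)
    also have "\<dots> = q i \<bullet> (J *v q j)"
      by (simp add: P_def matrix_matrix_mult_def matrix_vector_mult_def transpose_def inner_vec_def)
    finally show ?thesis .
  qed
  then have "transpose P ** J ** P = mat 1"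
    using q by (simp add: vec_eq_iff mat_def)
  moreover have "P $ i $ a = 0" if "a \<in> A" "i \<notin> A" for i a
    using that p qp by (simp add: P_def transpose_def)
  ultimately show ?thesis by (rule that)
qed

section \<open>Restriction to selected coordinates and the \<open>J\<close>-projection\<close>

text \<open>As a 0-1 matrix, restriction of vectors and matrices becomes matrix multiplication, so
  that later identities reduce to associativity and cancellation.\<close>

definition sel_mat :: "('s \<Rightarrow> 'i) \<Rightarrow> real^'i^'s" where
  "sel_mat \<iota> = (\<chi> s i. if i = \<iota> s then 1 else 0)"

lemma sel_mat_mult: "sel_mat \<iota> *v v = sub_vec \<iota> v"
  by (simp add: sel_mat_def sub_vec_def matrix_vector_mult_def vec_eq_iff if_distrib[of "\<lambda>x. x * _"] cong: if_cong)

lemma sel_mat_congruence: "sel_mat \<iota> ** A ** transpose (sel_mat \<iota>) = sub_mat \<iota> A"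
  by (simp add: sel_mat_def sub_mat_def matrix_matrix_mult_def transpose_def vec_eq_iff
      if_distrib[of "\<lambda>x. x * _"] if_distrib[of "\<lambda>x. _ * x"] cong: if_cong)

lemma sel_mat_transpose_mult:
  assumes "inj \<iota>" shows "sel_mat \<iota> ** transpose (sel_mat \<iota>) = mat 1"
  using assms by (auto simp: sel_mat_def matrix_matrix_mult_def transpose_def vec_eq_iff mat_def inj_def
      if_distrib[of "\<lambda>x. x * _"] cong: if_cong)

text \<open>With \<open>S = sel_mat \<iota>\<close>, the triangular shape of \<open>P\<close> gives
  \<open>P S' = S' Q\<close> for the block \<open>Q\<close> of \<open>P\<close>. Conjugating
  \<open>P' J P = I\<close> by \<open>S\<close> then yields the identity for \<open>Q\<close>, and
  factoring the inverse of the block as \<open>Q Q'\<close> together with \<open>Q' S = S P'\<close>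
  gives the last claim.\<close>

lemma pos_definite_sub_mat:
  fixes J :: "real^'i^'i" and \<iota> :: "'s::finite \<Rightarrow> 'i"
  assumes J: "pos_definite J" and \<iota>: "inj \<iota>"
  obtains P Q where "transpose P ** J ** P = mat 1" "transpose Q ** sub_mat \<iota> J ** Q = mat 1"
    "\<And>x. matrix_inv (sub_mat \<iota> J) *v sub_vec \<iota> (J *v (P *v x)) = Q *v sub_vec \<iota> x"
proof -
  let ?S = "sel_mat \<iota>"
  obtain P where P: "transpose P ** J ** P = mat 1"
    and sup: "\<And>i a. a \<in> range \<iota> \<Longrightarrow> i \<notin> range \<iota> \<Longrightarrow> P $ i $ a = 0"
    using pos_definite_congruence[OF J, where A = "range \<iota>"] by blast
  define Q where "Q = sub_mat \<iota> P"
  \<comment> \<open>The support condition enters here: column \<open>\<iota> t\<close> of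
    \<open>P\<close> vanishes off \<open>range \<iota>\<close>, so nothing is lost in passing to the
    block.\<close>
  have PS: "P ** transpose ?S = transpose ?S ** Q"
  proof -
    have "(P ** transpose ?S) $ i $ t = P $ i $ \<iota> t" for i t
      by (simp add: sel_mat_def matrix_matrix_mult_def transpose_def if_distrib[of "\<lambda>x. _ * x"] cong: if_cong)
    moreover have "(transpose ?S ** Q) $ i $ t = P $ i $ \<iota> t" for i t
    proof (cases "i \<in> range \<iota>")
      case True
      then obtain s where i: "i = \<iota> s" by blast
      have "(transpose ?S ** Q) $ i $ t = (\<Sum>r\<in>UNIV. if r = s then P $ \<iota> r $ \<iota> t else 0)"
        unfolding i sel_mat_def matrix_matrix_mult_def transpose_def Q_def sub_mat_def vec_lambda_beta
        by (rule sum.cong) (auto simp: inj_eq[OF \<iota>])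
      then show ?thesis by (simp add: i)
    next
      case False
      then have "(transpose ?S ** Q) $ i $ t = (\<Sum>r\<in>UNIV. 0)"
        by (auto simp: sel_mat_def matrix_matrix_mult_def transpose_def intro!: sum.neutral)
      then show ?thesis using sup[of "\<iota> t" i] False by simp
    qed
    ultimately show ?thesis by (simp add: vec_eq_iff)
  qed
  have tr: "transpose Q ** ?S = ?S ** transpose P"
    using arg_cong[OF PS, of transpose] by (simp add: matrix_transpose_mul)
  have "transpose Q ** sub_mat \<iota> J ** Q = (transpose Q ** ?S) ** J ** (transpose ?S ** Q)"
    by (simp add: sel_mat_congruence[symmetric] matrix_mul_assoc)
  also have "\<dots> = ?S ** (transpose P ** J ** P) ** transpose ?S"
    unfolding tr PS[symmetric] by (simp only: matrix_mul_assoc)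
  also have "\<dots> = mat 1"
    by (simp add: P sel_mat_transpose_mult[OF \<iota>])
  finally have Q: "transpose Q ** sub_mat \<iota> J ** Q = mat 1" .
  have "matrix_inv (sub_mat \<iota> J) ** ?S ** J ** P = Q ** (transpose Q ** ?S) ** J ** P"
    by (simp add: congruence_to_mat_1(1)[OF Q] matrix_mul_assoc)
  also have "\<dots> = Q ** ?S ** (transpose P ** J ** P)"
    unfolding tr by (simp only: matrix_mul_assoc)
  also have "\<dots> = Q ** ?S"
    by (simp add: P)
  finally have "matrix_inv (sub_mat \<iota> J) *v sub_vec \<iota> (J *v (P *v x)) = Q *v sub_vec \<iota> x" for x
    by (simp add: sel_mat_mult[symmetric] matrix_vector_mul_assoc matrix_mul_assoc)
  with P Q show ?thesis by (rule that)
qed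

text \<open>Both laws are images of a standard normal, by \<open>P\<close> and by \<open>Q\<close>.
  Along \<open>P\<close> the map reads only the selected coordinates, which are again standard
  normal.\<close>

lemma distr_multi_normal_projection:
  fixes J :: "real^'i^'i" and \<iota> :: "'s::finite \<Rightarrow> 'i"
  assumes J: "pos_definite J" and \<iota>: "inj \<iota>"
  shows "distr (multi_normal 0 (matrix_inv J)) borel (\<lambda>z. matrix_inv (sub_mat \<iota> J) *v sub_vec \<iota> (J *v z))
    = multi_normal 0 (matrix_inv (sub_mat \<iota> J))"
proof -
  obtain P Q where P: "transpose P ** J ** P = mat 1" and Q: "transpose Q ** sub_mat \<iota> J ** Q = mat 1"
    and PQ: "\<And>x. matrix_inv (sub_mat \<iota> J) *v sub_vec \<iota> (J *v (P *v x)) = Q *v sub_vec \<iota> x"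
    using pos_definite_sub_mat[OF J \<iota>] by blast
  show ?thesis
    unfolding multi_normal_eq_distr_std[OF P] multi_normal_eq_distr_std[OF Q]
    by (subst distr_distr, measurable)
      (simp add: o_def PQ distr_distr distr_sub_vec_std_normal[OF \<iota>, symmetric])
qed


text \<open>\<open>Wm\<close> is the \<open>J\<close>-orthogonal projection onto the vectors
  supported on \<open>range \<iota>\<close>; the last property is the first-order condition of that
  minimisation. Having it as a matrix provides the bound \<open>norm Wm * norm z\<close>.\<close>

lemma restricted_minimizer:
  fixes J :: "real^'i^'i" and \<iota> :: "'s::finite \<Rightarrow> 'i"
  assumes J: "pos_definite J" and \<iota>: "inj \<iota>"
  obtains Wm :: "real^'i^'i" where
    "\<And>z. sub_vec \<iota> (Wm *v z) = matrix_inv (sub_mat \<iota> J) *v sub_vec \<iota> (J *v z)"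
    "\<And>z i. i \<notin> range \<iota> \<Longrightarrow> (Wm *v z) $ i = 0"
    "\<And>z i. i \<in> range \<iota> \<Longrightarrow> (J *v (Wm *v z - z)) $ i = 0"
proof -
  let ?S = "sel_mat \<iota>" and ?B = "sub_mat \<iota> J"
  obtain P Q where "transpose P ** J ** P = mat 1" and Q: "transpose Q ** ?B ** Q = mat 1"
    and "\<And>x. matrix_inv ?B *v sub_vec \<iota> (J *v (P *v x)) = Q *v sub_vec \<iota> x"
    using pos_definite_sub_mat[OF J \<iota>] by blast
  have B: "?B ** matrix_inv ?B = mat 1"
    by (rule congruence_to_mat_1[OF Q])
  define Wm where "Wm = transpose ?S ** (matrix_inv ?B ** ?S ** J)"
  have "sub_vec \<iota> (Wm *v z) = matrix_inv ?B *v sub_vec \<iota> (J *v z)" for z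
  proof -
    have "?S ** Wm = (?S ** transpose ?S) ** matrix_inv ?B ** ?S ** J"
      unfolding Wm_def by (simp only: matrix_mul_assoc)
    also have "\<dots> = matrix_inv ?B ** ?S ** J"
      by (simp add: sel_mat_transpose_mult[OF \<iota>])
    finally have "?S *v (Wm *v z) = matrix_inv ?B *v (?S *v (J *v z))"
      by (simp add: matrix_vector_mul_assoc matrix_mul_assoc)
    then show ?thesis
      by (simp add: sel_mat_mult)
  qed
  moreover have "(Wm *v z) $ i = 0" if "i \<notin> range \<iota>" for z i
  proof -
    have "(transpose ?S *v y) $ i = 0" for y
      using that by (auto simp: sel_mat_def matrix_vector_mult_def transpose_def intro!: sum.neutral)
    then show ?thesis
      unfolding Wm_def by (simp only: matrix_vector_mul_assoc[symmetric])
  qed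
  moreover have "(J *v (Wm *v z - z)) $ i = 0" if "i \<in> range \<iota>" for z i
  proof -
    have "?S ** J ** Wm = (?S ** J ** transpose ?S) ** matrix_inv ?B ** ?S ** J"
      unfolding Wm_def by (simp only: matrix_mul_assoc)
    also have "\<dots> = ?S ** J"
      by (simp add: sel_mat_congruence B)
    finally have "?S *v (J *v (Wm *v z)) = ?S *v (J *v z)"
      by (simp add: matrix_vector_mul_assoc matrix_mul_assoc)
    then have "sub_vec \<iota> (J *v (Wm *v z - z)) = 0"
      by (simp add: sel_mat_mult[symmetric] matrix_vector_mult_diff_distrib)
    then show ?thesis
      using that by (auto simp: sub_vec_def vec_eq_iff)
  qed
  ultimately show ?thesis by (rule that)
qed

subsection \<open>Tightness and Slutsky's theorem\<close>

text \<open>The continuous function \<open>g K\<close> is 0 on the ball of radius \<open>K\<close>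
  and 1 beyond \<open>K + 1\<close>. Its integral under \<open>L\<close> becomes small by dominated
  convergence, and convergence in distribution passes this on to \<open>Y n\<close>; the tail bound
  holds beyond \<open>k + 1\<close>, where \<open>g k\<close> has reached 1.\<close>

lemma conv_in_dist_tight:
  fixes Y :: "nat \<Rightarrow> 'w \<Rightarrow> 'a::real_normed_vector"
  assumes "prob_space M" and "prob_space L" and L: "sets L = sets borel"
    and Y: "conv_in_dist M Y L" and e: "0 < e"
  shows "\<exists>K. \<forall>\<^sub>F n in sequentially. measure M {\<omega> \<in> space M. K < norm (Y n \<omega>)} < e"
proof -
  interpret M: prob_space M by fact
  interpret L: prob_space L by fact
  have [measurable_cong]: "sets L = sets borel" by (rule L)
  have spL: "space L = UNIV" using sets_eq_imp_space_eq[OF L] by simp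
  have [measurable]: "Y n \<in> borel_measurable M" for n
    using Y by (simp add: conv_in_dist_def)
  define g where "g K = (\<lambda>y::'a. min 1 (max 0 (norm y - K)))" for K :: real
  have cont: "continuous_on UNIV (g K)" and bd: "\<bar>g K y\<bar> \<le> 1" for K y
    by (auto simp: g_def intro!: continuous_intros)
  have [measurable]: "g K \<in> borel_measurable borel" for K
    using cont by (rule borel_measurable_continuous_onI)
  have "(\<lambda>k. \<integral>y. g (real k) y \<partial>L) \<longlonglongrightarrow> (\<integral>y. 0 \<partial>L)"
  proof (rule integral_dominated_convergence[where w = "\<lambda>_. 1"])
    show "AE y in L. (\<lambda>k. g (real k) y) \<longlonglongrightarrow> 0"
    proof (rule AE_I2, rule tendsto_eventually)
      fix y
      show "\<forall>\<^sub>F k in sequentially. g (real k) y = 0"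
        using eventually_ge_at_top[of "nat \<lceil>norm y\<rceil>"]
        by eventually_elim (auto simp: g_def nat_le_iff ceiling_le_iff)
    qed
  qed (use bd in auto)
  then have "\<forall>\<^sub>F k in sequentially. (\<integral>y. g (real k) y \<partial>L) < e"
    using e by (intro order_tendstoD) auto
  then obtain k :: nat where k: "(\<integral>y. g (real k) y \<partial>L) < e"
    by (auto simp: eventually_sequentially)
  have "(\<lambda>n. \<integral>\<omega>. g (real k) (Y n \<omega>) \<partial>M) \<longlonglongrightarrow> (\<integral>y. g (real k) y \<partial>L)"
    using Y cont[of k] bd unfolding conv_in_dist_def bounded_iff by (auto intro!: exI[of _ 1])
  then have "\<forall>\<^sub>F n in sequentially. (\<integral>\<omega>. g (real k) (Y n \<omega>) \<partial>M) < e"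
    using k by (rule order_tendstoD)
  then have "\<forall>\<^sub>F n in sequentially. measure M {\<omega> \<in> space M. real k + 1 < norm (Y n \<omega>)} < e"
  proof eventually_elim
    case (elim n)
    have "measure M {\<omega> \<in> space M. real k + 1 < norm (Y n \<omega>)}
        = (\<integral>\<omega>. indicator {\<omega> \<in> space M. real k + 1 < norm (Y n \<omega>)} \<omega> \<partial>M)"
      by (simp add: Int_def conj_commute)
    also have "\<dots> \<le> (\<integral>\<omega>. g (real k) (Y n \<omega>) \<partial>M)"
    proof (rule integral_mono)
      show "integrable M (\<lambda>\<omega>. g (real k) (Y n \<omega>))"
        using bd by (intro M.integrable_const_bound[where B = 1]) auto
      show "integrable M (\<lambda>\<omega>. indicator {\<omega> \<in> space M. real k + 1 < norm (Y n \<omega>)} \<omega> :: real)"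
        by (intro M.integrable_const_bound[where B = 1]) auto
    qed (auto simp: indicator_def g_def)
    finally show ?case using elim by simp
  qed
  then show ?thesis by blast
qed

text \<open>Continuous mapping and Slutsky in one. Tightness of \<open>Y\<close> confines
  \<open>T (Y n \<omega>)\<close>, and with it the nearby \<open>V n \<omega>\<close>, to a ball on
  which \<open>f\<close> is uniformly continuous, up to events of small probability.\<close>

lemma slutsky_continuous:
  fixes Y :: "nat \<Rightarrow> 'w \<Rightarrow> 'a::euclidean_space" and V :: "nat \<Rightarrow> 'w \<Rightarrow> 'b::euclidean_space"
  assumes M: "prob_space M" and L: "prob_space L" "sets L = sets borel"
    and Y: "conv_in_dist M Y L" and T: "continuous_on UNIV T"
    and V: "\<And>n. V n \<in> borel_measurable M"
    and VY: "\<And>\<delta>. 0 < \<delta> \<Longrightarrow> (\<lambda>n. measure M {\<omega> \<in> space M. \<delta> < norm (V n \<omega> - T (Y n \<omega>))}) \<longlonglongrightarrow> 0"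
  shows "conv_in_dist M V (distr L borel T)"
  unfolding conv_in_dist_def
proof (intro conjI allI impI)
  interpret M: prob_space M by fact
  interpret L: prob_space L by fact
  have [measurable_cong]: "sets L = sets borel" by (rule L)
  note [measurable] = V
  have [measurable]: "Y n \<in> borel_measurable M" for n
    using Y by (simp add: conv_in_dist_def)
  have [measurable]: "T \<in> borel_measurable borel"
    using T by (rule borel_measurable_continuous_onI)
  show "V n \<in> borel_measurable M" for n by fact
  fix f :: "'b \<Rightarrow> real" assume "continuous_on UNIV f \<and> bounded (range f)"
  then have f: "continuous_on UNIV f" and "bounded (range f)" by auto
  then obtain C0 where "\<And>x. \<bar>f x\<bar> \<le> C0" by (auto simp: bounded_iff)
  then obtain C where C: "\<And>x. \<bar>f x\<bar> \<le> C" "0 < C"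
    by (intro that[of "max C0 1"]) (auto simp: le_max_iff_disj)
  have [measurable]: "f \<in> borel_measurable borel"
    using f by (rule borel_measurable_continuous_onI)
  have "continuous_on UNIV (\<lambda>y. f (T y))"
    by (rule continuous_on_compose2[OF f T]) auto
  moreover have "bounded (range (\<lambda>y. f (T y)))"
    using C by (auto simp: bounded_iff)
  ultimately have lim: "(\<lambda>n. \<integral>\<omega>. f (T (Y n \<omega>)) \<partial>M) \<longlonglongrightarrow> (\<integral>y. f (T y) \<partial>L)"
    using Y unfolding conv_in_dist_def by blast
  have int: "integrable M (\<lambda>\<omega>. f (V n \<omega>))" "integrable M (\<lambda>\<omega>. f (T (Y n \<omega>)))" for n
    using C by (intro M.integrable_const_bound[where B = C]; simp)+
  have "(\<lambda>n. (\<integral>\<omega>. f (V n \<omega>) \<partial>M) - (\<integral>\<omega>. f (T (Y n \<omega>)) \<partial>M)) \<longlonglongrightarrow> 0"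
  proof (rule tendstoI)
    fix e :: real assume e: "0 < e"
    \<comment> \<open>The errors below add up to \<open>e' * (1 + 4 * C)\<close>: one
      \<open>e'\<close> from uniform continuity and \<open>2 * C * e'\<close> from each of two
      exceptional events.\<close>
    define e' where "e' = e / (2 + 4 * C)"
    have e': "0 < e'" using e C by (simp add: e'_def)
    obtain K where K: "\<forall>\<^sub>F n in sequentially. measure M {\<omega> \<in> space M. K < norm (Y n \<omega>)} < e'"
      using conv_in_dist_tight[OF M L Y e'] by blast
    have "compact (T ` cball 0 K)"
      by (intro compact_continuous_image continuous_on_subset[OF T]) auto
    then obtain R where R: "\<And>y. norm y \<le> K \<Longrightarrow> norm (T y) \<le> R"
      by (meson compact_imp_bounded bounded_iff imageI mem_cball_0)
    \<comment> \<open>The radius is \<open>R + 1\<close> because \<open>V n \<omega>\<close> lies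
      within \<open>\<delta> \<le> 1\<close> of a point of norm at most \<open>R\<close>.\<close>
    have "uniformly_continuous_on (cball 0 (R + 1)) f"
      by (intro compact_uniformly_continuous continuous_on_subset[OF f]) auto
    then obtain d where d: "0 < d"
      "\<And>x y. x \<in> cball 0 (R + 1) \<Longrightarrow> y \<in> cball 0 (R + 1) \<Longrightarrow> dist y x < d \<Longrightarrow> dist (f y) (f x) < e'"
      unfolding uniformly_continuous_on_def using e' by metis
    define \<delta> where "\<delta> = min 1 (d / 2)"
    have \<delta>: "0 < \<delta>" "\<delta> < d" "\<delta> \<le> 1" using d by (auto simp: \<delta>_def)
    have "\<forall>\<^sub>F n in sequentially. measure M {\<omega> \<in> space M. \<delta> < norm (V n \<omega> - T (Y n \<omega>))} < e'"
      using VY[OF \<delta>(1)] e' by (rule order_tendstoD)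
    with K show "\<forall>\<^sub>F n in sequentially. dist ((\<integral>\<omega>. f (V n \<omega>) \<partial>M) - (\<integral>\<omega>. f (T (Y n \<omega>)) \<partial>M)) 0 < e"
    proof eventually_elim
      case (elim n)
      let ?A = "{\<omega> \<in> space M. K < norm (Y n \<omega>)}" and ?B = "{\<omega> \<in> space M. \<delta> < norm (V n \<omega> - T (Y n \<omega>))}"
      have pw: "\<bar>f (V n \<omega>) - f (T (Y n \<omega>))\<bar> \<le> e' + 2 * C * indicator ?A \<omega> + 2 * C * indicator ?B \<omega>"
        if \<omega>: "\<omega> \<in> space M" for \<omega>
      proof (cases "\<omega> \<in> ?A \<union> ?B")
        case True
        have "\<bar>f (V n \<omega>) - f (T (Y n \<omega>))\<bar> \<le> 2 * C"
          using C(1)[of "V n \<omega>"] C(1)[of "T (Y n \<omega>)"] by linarith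
        with True show ?thesis
          using e' C(2) by (auto simp: indicator_def)
      next
        case False
        then have 1: "norm (T (Y n \<omega>)) \<le> R" and 2: "norm (V n \<omega> - T (Y n \<omega>)) \<le> \<delta>"
          using \<omega> R by auto
        have "norm (V n \<omega>) \<le> norm (T (Y n \<omega>)) + norm (V n \<omega> - T (Y n \<omega>))"
          by (metis add.commute norm_triangle_sub)
        then have "dist (f (V n \<omega>)) (f (T (Y n \<omega>))) < e'"
          using 1 2 \<delta> by (intro d) (auto simp: dist_norm)
        then show ?thesis
          using C(2) by (auto simp: dist_real_def indicator_def)
      qed
      have "\<bar>(\<integral>\<omega>. f (V n \<omega>) \<partial>M) - (\<integral>\<omega>. f (T (Y n \<omega>)) \<partial>M)\<bar>
          = \<bar>\<integral>\<omega>. f (V n \<omega>) - f (T (Y n \<omega>)) \<partial>M\<bar>"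
        using int by simp
      also have "\<dots> \<le> (\<integral>\<omega>. \<bar>f (V n \<omega>) - f (T (Y n \<omega>))\<bar> \<partial>M)"
        by (rule integral_abs_bound)
      also have "\<dots> \<le> (\<integral>\<omega>. e' + 2 * C * indicator ?A \<omega> + 2 * C * indicator ?B \<omega> \<partial>M)"
        using int by (intro integral_mono pw Bochner_Integration.integrable_add integrable_mult_right
            M.integrable_const integrable_real_indicator integrable_abs Bochner_Integration.integrable_diff)
          (auto simp: less_top[symmetric])
      also have "\<dots> = e' + 2 * C * measure M ?A + 2 * C * measure M ?B"
      proof -
        have "integrable M (indicator ?A :: _ \<Rightarrow> real)" "integrable M (indicator ?B :: _ \<Rightarrow> real)"
          by (auto intro!: integrable_real_indicator simp: less_top[symmetric])
        then show ?thesis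
          by (simp add: M.prob_space Int_def conj_commute)
      qed
      also have "\<dots> < e' + 2 * C * e' + 2 * C * e'"
        using elim C(2) by (intro add_strict_mono add_le_less_mono mult_strict_left_mono) auto
      also have "\<dots> = e' * (1 + 4 * C)"
        by (simp add: algebra_simps)
      also have "\<dots> \<le> e' * (2 + 4 * C)"
        using e' by (intro mult_left_mono) auto
      also have "\<dots> = e"
        using C(2) by (simp add: e'_def)
      finally show ?case by (simp add: dist_real_def)
    qed
  qed
  from tendsto_add[OF this lim] show "(\<lambda>n. \<integral>\<omega>. f (V n \<omega>) \<partial>M) \<longlonglongrightarrow> (\<integral>y. f y \<partial>distr L borel T)"
    by (simp add: integral_distr)
qed

subsection \<open>Minimisers of penalised quadratic forms\<close>

text \<open>The norm of \<open>real^'n^'m\<close> is the Frobenius norm, so Cauchy-Schwarz on each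
  row is enough.\<close>

lemma norm_matrix_vector_mult_le:
  fixes A :: "real^'n^'m"
  shows "norm (A *v x) \<le> norm A * norm x"
proof -
  have "norm (A *v x) \<le> L2_set (\<lambda>i. norm (A $ i) * norm x) UNIV"
    unfolding norm_vec_def[of "A *v x"]
  proof (rule L2_set_mono)
    fix i
    have "(A *v x) $ i = A $ i \<bullet> x"
      by (simp add: matrix_vector_mult_def inner_vec_def)
    then show "norm ((A *v x) $ i) \<le> norm (A $ i) * norm x"
      by (simp add: Cauchy_Schwarz_ineq2)
  qed simp
  also have "\<dots> = norm A * norm x"
    by (simp add: L2_set_left_distrib norm_vec_def[of A])
  finally show ?thesis .
qed

text \<open>The constant is the minimum of the form on the compact unit sphere; homogeneity extends
  the bound to all vectors.\<close>

lemma pos_definite_coercive: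
  fixes J :: "real^'n^'n"
  assumes "pos_definite J"
  obtains c where "0 < c" "\<And>v. c * (norm v)\<^sup>2 \<le> v \<bullet> (J *v v)"
proof -
  have "sphere (0 :: real^'n) 1 \<noteq> {}"
    by (rule ex_in_conv[THEN iffD1], rule exI[of _ "axis undefined 1"]) simp
  then obtain x where x: "norm x = 1" "\<And>y. norm y = 1 \<Longrightarrow> x \<bullet> (J *v x) \<le> y \<bullet> (J *v y)"
    using continuous_attains_inf[of "sphere (0 :: real^'n) 1" "\<lambda>v. v \<bullet> (J *v v)"]
    by (fastforce simp: continuous_on_inner matrix_vector_mult_linear_continuous_on)
  have "x \<bullet> (J *v x) * (norm v)\<^sup>2 \<le> v \<bullet> (J *v v)" for v
  proof (cases "v = 0")
    case False
    then have "x \<bullet> (J *v x) \<le> sgn v \<bullet> (J *v sgn v)"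
      by (intro x) (simp add: norm_sgn)
    also have "\<dots> = (v \<bullet> (J *v v)) / (norm v)\<^sup>2"
      by (simp add: sgn_div_norm matrix_vector_mult_scaleR power2_eq_square divide_inverse mult_ac)
    finally show ?thesis
      using False by (simp add: field_simps)
  qed simp
  moreover have "0 < x \<bullet> (J *v x)"
    using assms x(1) unfolding pos_definite_def by (metis norm_zero zero_neq_one)
  ultimately show ?thesis using that by blast
qed

text \<open>The deterministic core. Expanding the objective at \<open>u = w + h\<close> leaves the
  coercive term of \<open>J\<close>, a linear term in \<open>J *v (w - z)\<close>, and errors
  controlled by \<open>A - J\<close>. Penalty and linear term together cost at most
  \<open>\<epsilon> * norm h\<close> per coordinate, so one factor \<open>norm h\<close>
  cancels.\<close>

lemma penalized_quadratic_minimizer_bound: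
  fixes A J :: "real^'n^'n" and u w z t :: "real^'n" and l s :: "'n \<Rightarrow> real"
  assumes coercive: "\<And>v. c * (norm v)\<^sup>2 \<le> v \<bullet> (J *v v)" and sym: "transpose J = J"
    and le: "(u - z) \<bullet> (A *v (u - z)) + (\<Sum>i\<in>UNIV. l i * \<bar>t $ i + u $ i / s i\<bar>)
      \<le> (w - z) \<bullet> (A *v (w - z)) + (\<Sum>i\<in>UNIV. l i * \<bar>t $ i + w $ i / s i\<bar>)"
    and s: "\<And>i. 0 < s i" and l: "\<And>i. 0 \<le> l i"
    and w: "\<And>i. t $ i = 0 \<Longrightarrow> w $ i = 0" "\<And>i. t $ i \<noteq> 0 \<Longrightarrow> (J *v (w - z)) $ i = 0"
    and A: "norm (A - J) \<le> \<eta>" "\<eta> \<le> c / 2" and R: "norm (w - z) \<le> R"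
    and active: "\<And>i. t $ i \<noteq> 0 \<Longrightarrow> l i / s i \<le> \<epsilon>" and \<epsilon>: "0 \<le> \<epsilon>"
    and inactive: "\<And>i. t $ i = 0 \<Longrightarrow> 2 * norm (J *v (w - z)) \<le> l i / s i"
  shows "c / 2 * norm (u - w) \<le> real CARD('n) * \<epsilon> + 2 * \<eta> * R"
proof -
  define h where "h = u - w"
  define r where "r = w - z"
  define E where "E = A - J"
  have A_eq: "A = J + E" and u: "u = w + h" and uz: "u - z = h + r"
    by (simp_all add: E_def h_def r_def)
  have bil: "\<bar>x \<bullet> (E *v y)\<bar> \<le> \<eta> * norm x * norm y" for x y
  proof -
    have "\<bar>x \<bullet> (E *v y)\<bar> \<le> norm x * norm (E *v y)"
      by (rule Cauchy_Schwarz_ineq2)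
    also have "\<dots> \<le> norm x * (norm E * norm y)"
      by (intro mult_left_mono norm_matrix_vector_mult_le) simp
    also have "\<dots> \<le> norm x * (\<eta> * norm y)"
      using A(1) by (intro mult_left_mono mult_right_mono) (auto simp: E_def)
    finally show ?thesis by (simp add: mult_ac)
  qed
  have \<eta>: "0 \<le> \<eta>" using A(1) norm_ge_zero order_trans by blast
  have Jr: "r \<bullet> (J *v h) = h \<bullet> (J *v r)"
    using sym by (metis dot_lmul_matrix inner_commute transpose_matrix_vector)
  \<comment> \<open>The two cross terms of \<open>J\<close> merge by symmetry; those of
    \<open>E\<close> are kept apart, \<open>A\<close> being an arbitrary matrix near
    \<open>J\<close>.\<close>
  have quad: "(u - z) \<bullet> (A *v (u - z)) - r \<bullet> (A *v r)
    = h \<bullet> (J *v h) + 2 * (h \<bullet> (J *v r)) + h \<bullet> (E *v h) + h \<bullet> (E *v r) + r \<bullet> (E *v h)"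
    unfolding uz A_eq
    by (simp add: matrix_vector_mult_add_rdistrib matrix_vector_right_distrib inner_add_left inner_add_right Jr)
  \<comment> \<open>Where \<open>t $ i = 0\<close>, also \<open>w $ i = 0\<close>, so the penalty
    rises by exactly \<open>l i / s i * \<bar>h $ i\<bar>\<close> and outweighs the linear term.
    Elsewhere the linear term vanishes and the penalty falls by at most
    \<open>\<epsilon> * norm h\<close>.\<close>
  have pen: "- \<epsilon> * norm h \<le> 2 * (h $ i * (J *v r) $ i) + (l i * \<bar>t $ i + u $ i / s i\<bar> - l i * \<bar>t $ i + w $ i / s i\<bar>)" for i
  proof (cases "t $ i = 0")
    case True
    have "- (2 * (h $ i * (J *v r) $ i)) \<le> 2 * (\<bar>h $ i\<bar> * norm (J *v r))"
    proof -
      have "- (h $ i * (J *v r) $ i) \<le> \<bar>h $ i\<bar> * \<bar>(J *v r) $ i\<bar>"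
        by (metis abs_ge_minus_self abs_mult)
      also have "\<dots> \<le> \<bar>h $ i\<bar> * norm (J *v r)"
        by (intro mult_left_mono component_le_norm_cart) simp
      finally show ?thesis by linarith
    qed
    also have "\<dots> = 2 * norm (J *v r) * \<bar>h $ i\<bar>" by simp
    also have "\<dots> \<le> l i / s i * \<bar>h $ i\<bar>"
      using inactive[OF True] by (intro mult_right_mono) (auto simp: r_def)
    also have "\<dots> = l i * \<bar>t $ i + u $ i / s i\<bar> - l i * \<bar>t $ i + w $ i / s i\<bar>"
      using True w(1)[OF True] s[of i] by (simp add: u abs_divide)
    finally show ?thesis
      using \<epsilon> mult_nonneg_nonneg[OF \<epsilon> norm_ge_zero[of h]] by linarith
  next
    case False
    have "(t $ i + w $ i / s i) - (t $ i + u $ i / s i) = - (h $ i / s i)"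
      by (simp add: u diff_divide_distrib add_divide_distrib)
    then have "\<bar>t $ i + w $ i / s i\<bar> - \<bar>t $ i + u $ i / s i\<bar> \<le> \<bar>h $ i\<bar> / s i"
      using s[of i] by (metis abs_divide abs_minus_cancel abs_of_pos abs_triangle_ineq2)
    then have "l i * (\<bar>t $ i + w $ i / s i\<bar> - \<bar>t $ i + u $ i / s i\<bar>) \<le> l i * (\<bar>h $ i\<bar> / s i)"
      using l by (rule mult_left_mono)
    also have "\<dots> = l i / s i * \<bar>h $ i\<bar>" by simp
    also have "\<dots> \<le> \<epsilon> * norm h"
      using active[OF False] \<epsilon> by (intro mult_mono component_le_norm_cart) auto
    finally show ?thesis
      using w(2)[OF False] by (simp add: r_def algebra_simps)
  qed
  have "(\<Sum>i\<in>(UNIV::'n set). - \<epsilon> * norm h)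
      \<le> (\<Sum>i\<in>UNIV. 2 * (h $ i * (J *v r) $ i) + (l i * \<bar>t $ i + u $ i / s i\<bar> - l i * \<bar>t $ i + w $ i / s i\<bar>))"
    by (intro sum_mono pen)
  then have "- (real CARD('n) * \<epsilon> * norm h) \<le> 2 * (h \<bullet> (J *v r))
      + ((\<Sum>i\<in>UNIV. l i * \<bar>t $ i + u $ i / s i\<bar>) - (\<Sum>i\<in>UNIV. l i * \<bar>t $ i + w $ i / s i\<bar>))"
    by (simp add: sum.distrib sum_subtractf inner_vec_def sum_distrib_left mult.assoc)
  with le quad have "h \<bullet> (J *v h) + h \<bullet> (E *v h) + h \<bullet> (E *v r) + r \<bullet> (E *v h) \<le> real CARD('n) * \<epsilon> * norm h"
    unfolding r_def[symmetric] by linarith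
  then have "c * (norm h)\<^sup>2 - \<eta> * norm h * norm h - \<eta> * norm h * norm r - \<eta> * norm r * norm h
      \<le> real CARD('n) * \<epsilon> * norm h"
    using coercive[of h] bil[of h h] bil[of h r] bil[of r h] by linarith
  then have "norm h * ((c - \<eta>) * norm h) \<le> norm h * (real CARD('n) * \<epsilon> + 2 * \<eta> * norm r)"
    by (simp add: power2_eq_square algebra_simps)
  then have *: "(c - \<eta>) * norm h \<le> real CARD('n) * \<epsilon> + 2 * \<eta> * norm r"
    using \<epsilon> \<eta> by (cases "h = 0") auto
  have "c / 2 * norm h \<le> (c - \<eta>) * norm h"
    using A(2) by (intro mult_right_mono) auto
  also note *
  also have "2 * \<eta> * norm r \<le> 2 * \<eta> * R"
    using R \<eta> by (intro mult_left_mono) (auto simp: r_def)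
  finally show ?thesis by (simp add: h_def)
qed

subsection \<open>The rescaled LASSO estimator\<close>

text \<open>This moves the limit of the scaled Hessian from the fixed true parameter to the random
  plug-in point. A deviation beyond \<open>e\<close> forces one of the two known deviations beyond
  \<open>e / 2\<close>.\<close>

lemma conv_in_prob_close:
  fixes X Y :: "nat \<Rightarrow> 'w \<Rightarrow> 'a::euclidean_space"
  assumes M: "prob_space M" and X: "conv_in_prob M X (\<lambda>_. a) sequentially"
    and D: "conv_in_prob M (\<lambda>n \<omega>. Y n \<omega> - X n \<omega>) (\<lambda>_. 0) sequentially"
  shows "conv_in_prob M Y (\<lambda>_. a) sequentially"
  unfolding conv_in_prob_def
proof (intro conjI allI impI)
  interpret prob_space M by fact
  have mX: "\<forall>\<^sub>F n in sequentially. X n \<in> borel_measurable M"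
    and mD: "\<forall>\<^sub>F n in sequentially. (\<lambda>\<omega>. Y n \<omega> - X n \<omega>) \<in> borel_measurable M"
    using X D by (auto simp: conv_in_prob_def)
  show "\<forall>\<^sub>F n in sequentially. Y n \<in> borel_measurable M"
    using mX mD
  proof eventually_elim
    case (elim n)
    have "(\<lambda>\<omega>. X n \<omega> + (Y n \<omega> - X n \<omega>)) \<in> borel_measurable M"
      using elim by (rule borel_measurable_add)
    then show ?case by simp
  qed
  fix e :: real assume e: "0 < e"
  let ?A = "\<lambda>n. {\<omega> \<in> space M. e / 2 < dist (X n \<omega>) a}"
  let ?B = "\<lambda>n. {\<omega> \<in> space M. e / 2 < dist (Y n \<omega> - X n \<omega>) 0}"
  have "(\<lambda>n. prob (?A n) + prob (?B n)) \<longlonglongrightarrow> 0 + 0"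
    using X D half_gt_zero[OF e] unfolding conv_in_prob_def by (intro tendsto_add) blast+
  then have lim: "(\<lambda>n. prob (?A n) + prob (?B n)) \<longlonglongrightarrow> 0" by simp
  have "\<forall>\<^sub>F n in sequentially. prob {\<omega> \<in> space M. e < dist (Y n \<omega>) a} \<le> prob (?A n) + prob (?B n)"
    using mX mD
  proof eventually_elim
    case (elim n)
    note [measurable] = elim
    have s: "?A n \<in> events" "?B n \<in> events" by measurable
    have "dist (Y n \<omega>) a \<le> dist (X n \<omega>) a + dist (Y n \<omega> - X n \<omega>) 0" for \<omega>
      using norm_triangle_ineq[of "X n \<omega> - a" "Y n \<omega> - X n \<omega>"] by (simp add: dist_norm)
    then have "\<not> (dist (X n \<omega>) a \<le> e / 2 \<and> dist (Y n \<omega> - X n \<omega>) 0 \<le> e / 2)" if "e < dist (Y n \<omega>) a" for \<omega>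
      using that by (smt (verit) field_sum_of_halves)
    then have "{\<omega> \<in> space M. e < dist (Y n \<omega>) a} \<subseteq> ?A n \<union> ?B n"
      by fastforce
    then have "prob {\<omega> \<in> space M. e < dist (Y n \<omega>) a} \<le> prob (?A n \<union> ?B n)"
      using s by (intro finite_measure_mono) auto
    also have "\<dots> \<le> prob (?A n) + prob (?B n)"
      using s by (rule measure_Un_le)
    finally show ?case .
  qed
  then show "(\<lambda>n. prob {\<omega> \<in> space M. e < dist (Y n \<omega>) a}) \<longlonglongrightarrow> 0"
    by (rule tendsto_sandwich[OF _ _ tendsto_const lim, rotated]) simp
qed simp

section \<open>Rates and the objective in rescaled coordinates\<close>

lemma diag_mat_mult_component [simp]: "(diag_mat f *v x) $ i = f i * x $ i"
proof -
  have "(diag_mat f *v x) $ i = (\<Sum>j\<in>UNIV. if j = i then f i * x $ i else 0)"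
    unfolding diag_mat_def matrix_vector_mult_def vec_lambda_beta by (rule sum.cong) auto
  then show ?thesis by simp
qed

lemma phi_pow_mult_component [simp]: "(phi_pow r \<Delta> n *v x) $ i = rate \<Delta> n i powr r * x $ i"
  by (simp add: phi_pow_def)

lemma rate_pos: "0 < n \<Longrightarrow> 0 < \<Delta> n \<Longrightarrow> 0 < rate \<Delta> n i"
  by (cases i) (simp_all add: rate_def)

lemma powr_half_eq: "x powr (1/2) = inverse (x powr (-1/2))" for x :: real
  using powr_minus[of x "1/2"] by simp

text \<open>This includes \<open>n = 0\<close>, where both sides are \<open>0\<close>.\<close>

lemma rate_powr_minus_half:
  assumes "0 < \<Delta> n"
  shows "rate \<Delta> n (Inl j) powr (-1/2) = sqrt (real n * \<Delta> n)"
    and "rate \<Delta> n (Inr k) powr (-1/2) = sqrt (real n)"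
proof -
  have "(1 / x) powr (-1/2) = sqrt x" if "0 \<le> x" for x :: real
  proof -
    have "(1 / x) powr (-1/2) = inverse ((1 / x) powr (1/2))"
      using powr_minus[of "1 / x" "1/2"] by simp
    also have "\<dots> = sqrt x"
      using that by (simp add: powr_half_sqrt real_sqrt_divide)
    finally show ?thesis .
  qed
  then show "rate \<Delta> n (Inl j) powr (-1/2) = sqrt (real n * \<Delta> n)"
    and "rate \<Delta> n (Inr k) powr (-1/2) = sqrt (real n)"
    using assms by (simp_all add: rate_def)
qed

text \<open>Joining the two penalties under \<open>case_sum\<close> lets drift and diffusion
  coordinates be treated alike; they then differ only in their rates.\<close>

lemma lasso_objective_sum:
  "lasso_objective A \<theta>t l g \<theta> = (\<theta> - \<theta>t) \<bullet> (A *v (\<theta> - \<theta>t)) + (\<Sum>i\<in>UNIV. case_sum l g i * \<bar>\<theta> $ i\<bar>)"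
proof -
  have "(\<Sum>i\<in>UNIV. case_sum l g i * \<bar>\<theta> $ i\<bar>)
      = (\<Sum>j\<in>UNIV. l j * \<bar>\<theta> $ Inl j\<bar>) + (\<Sum>k\<in>UNIV. g k * \<bar>\<theta> $ Inr k\<bar>)"
    using sum.Plus[of UNIV UNIV "\<lambda>i. case_sum l g i * \<bar>\<theta> $ i\<bar>"] by simp
  then show ?thesis
    by (simp add: lasso_objective_def drift_par_def diff_par_def)
qed

text \<open>The substitution of \<open>\<theta>0 + phi_pow (1/2) \<Delta> n *v v\<close> for the
  parameter turns the LASSO objective into the penalised quadratic form above. The minimiser may be
  compared with \<open>w\<close> because the parameter belonging to \<open>w\<close> lies in
  \<open>\<Theta>\<close>.\<close>

lemma lasso_minimizer_bound:
  fixes \<theta>0 \<theta>t \<theta>h w :: "real^('p::finite + 'q::finite)" and J Hs :: "real^('p + 'q)^('p + 'q)"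
    and \<Delta> :: "nat \<Rightarrow> real" and n :: nat
  defines "s \<equiv> \<lambda>i. rate \<Delta> n i powr (-1/2)"
    and "u \<equiv> phi_pow (-1/2) \<Delta> n *v (\<theta>h - \<theta>0)" and "z \<equiv> phi_pow (-1/2) \<Delta> n *v (\<theta>t - \<theta>0)"
  assumes n: "0 < n" "0 < \<Delta> n"
    and min: "is_arg_min (lasso_objective Hs \<theta>t l g) (\<lambda>\<theta>. \<theta> \<in> \<Theta>) \<theta>h"
    and w\<Theta>: "\<theta>0 + phi_pow (1/2) \<Delta> n *v w \<in> \<Theta>"
    and coercive: "\<And>v. c * (norm v)\<^sup>2 \<le> v \<bullet> (J *v v)" and sym: "transpose J = J"
    and l: "\<And>i. 0 \<le> case_sum l g i"
    and w: "\<And>i. \<theta>0 $ i = 0 \<Longrightarrow> w $ i = 0" "\<And>i. \<theta>0 $ i \<noteq> 0 \<Longrightarrow> (J *v (w - z)) $ i = 0"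
    and A: "norm (phi_pow (1/2) \<Delta> n ** Hs ** phi_pow (1/2) \<Delta> n - J) \<le> \<eta>" "\<eta> \<le> c / 2"
    and R: "norm (w - z) \<le> R"
    and active: "\<And>i. \<theta>0 $ i \<noteq> 0 \<Longrightarrow> case_sum l g i / s i \<le> \<epsilon>" and \<epsilon>: "0 \<le> \<epsilon>"
    and inactive: "\<And>i. \<theta>0 $ i = 0 \<Longrightarrow> 2 * norm (J *v (w - z)) \<le> case_sum l g i / s i"
  shows "c / 2 * norm (u - w) \<le> real CARD('p + 'q) * \<epsilon> + 2 * \<eta> * R"
proof -
  let ?D = "phi_pow (1/2) \<Delta> n :: real^('p + 'q)^('p + 'q)"
  let ?A = "?D ** Hs ** ?D"
  have s: "0 < s i" for i
    using rate_pos[of n \<Delta> i, OF n] by (simp add: s_def)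
  have half: "rate \<Delta> n i powr (1/2) = 1 / s i" for i
    unfolding s_def by (simp only: powr_half_eq inverse_eq_divide)
  have D: "(?D *v v) $ i = v $ i / s i" for v i
    by (simp add: half)
  have s0: "s i \<noteq> 0" for i
    using s[of i] by simp
  have zi: "z $ i / s i = \<theta>t $ i - \<theta>0 $ i" and ui: "u $ i / s i = \<theta>h $ i - \<theta>0 $ i" for i
  proof -
    have "z $ i = s i * (\<theta>t $ i - \<theta>0 $ i)" "u $ i = s i * (\<theta>h $ i - \<theta>0 $ i)"
      by (simp_all only: z_def u_def s_def phi_pow_mult_component vector_minus_component)
    then show "z $ i / s i = \<theta>t $ i - \<theta>0 $ i" "u $ i / s i = \<theta>h $ i - \<theta>0 $ i"
      using s0[of i] by simp_all
  qed
  \<comment> \<open>The diagonal matrix moves across the inner product, which puts one factor on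
    each side of \<open>Hs\<close>.\<close>
  have inner_D: "x \<bullet> (?D *v y) = (?D *v x) \<bullet> y" for x y
    unfolding inner_vec_def by (simp add: mult_ac)
  have obj: "lasso_objective Hs \<theta>t l g (\<theta>0 + ?D *v v)
      = (v - z) \<bullet> (?A *v (v - z)) + (\<Sum>i\<in>UNIV. case_sum l g i * \<bar>\<theta>0 $ i + v $ i / s i\<bar>)" for v
  proof -
    have "\<theta>0 + ?D *v v - \<theta>t = ?D *v (v - z)"
      by (simp add: vec_eq_iff D diff_divide_distrib zi del: phi_pow_mult_component)
    then have "(\<theta>0 + ?D *v v - \<theta>t) \<bullet> (Hs *v (\<theta>0 + ?D *v v - \<theta>t)) = (v - z) \<bullet> (?A *v (v - z))"
      by (simp only: inner_D[symmetric] matrix_vector_mul_assoc[symmetric])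
    then show ?thesis
      unfolding lasso_objective_sum by (simp only: vector_add_component D)
  qed
  have \<theta>h: "\<theta>h = \<theta>0 + ?D *v u"
    by (simp add: vec_eq_iff D ui del: phi_pow_mult_component)
  have "lasso_objective Hs \<theta>t l g \<theta>h \<le> lasso_objective Hs \<theta>t l g (\<theta>0 + ?D *v w)"
    using min w\<Theta> by (auto simp: is_arg_min_def not_less)
  then have "(u - z) \<bullet> (?A *v (u - z)) + (\<Sum>i\<in>UNIV. case_sum l g i * \<bar>\<theta>0 $ i + u $ i / s i\<bar>)
      \<le> (w - z) \<bullet> (?A *v (w - z)) + (\<Sum>i\<in>UNIV. case_sum l g i * \<bar>\<theta>0 $ i + w $ i / s i\<bar>)"
    by (simp only: \<theta>h obj)
  from penalized_quadratic_minimizer_bound[OF coercive sym this s l w A R active \<epsilon> inactive]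
  show ?thesis .
qed

text \<open>For large \<open>n\<close>, outside the events that \<open>z\<close> is large or that
  the scaled Hessian is far from \<open>J\<close>, the deterministic bound applies with
  \<open>w = Wm *v z\<close>. Each of the two events has probability below
  \<open>e / 2\<close>.\<close>

lemma lasso_minimizer_near_projection:
  fixes \<theta>0 :: "real^('p::finite + 'q::finite)" and \<theta>t \<theta>h :: "nat \<Rightarrow> 'w \<Rightarrow> real^('p + 'q)"
    and Hs :: "nat \<Rightarrow> 'w \<Rightarrow> real^('p + 'q)^('p + 'q)" and Wm J :: "real^('p + 'q)^('p + 'q)"
    and \<Delta> :: "nat \<Rightarrow> real"
  defines "u \<equiv> \<lambda>n \<omega>. phi_pow (-1/2) \<Delta> n *v (\<theta>h n \<omega> - \<theta>0)"
    and "z \<equiv> \<lambda>n \<omega>. phi_pow (-1/2) \<Delta> n *v (\<theta>t n \<omega> - \<theta>0)"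
    and "s \<equiv> \<lambda>n i. rate \<Delta> n i powr (-1/2)"
  assumes M: "prob_space M" and J: "pos_definite J" and \<Theta>: "open \<Theta>" "\<theta>0 \<in> \<Theta>"
    and \<Delta>: "\<And>n. 0 < \<Delta> n" "filterlim (\<lambda>n. real n * \<Delta> n) at_top sequentially"
    and l: "\<And>n j. 0 < l n j" "\<And>n k. 0 < g n k"
    and active: "\<And>i. \<theta>0 $ i \<noteq> 0 \<Longrightarrow> (\<lambda>n. case_sum (l n) (g n) i / s n i) \<longlonglongrightarrow> 0"
    and inactive: "\<And>i. \<theta>0 $ i = 0 \<Longrightarrow> filterlim (\<lambda>n. case_sum (l n) (g n) i / s n i) at_top sequentially"
    and W: "\<And>z i. \<theta>0 $ i = 0 \<Longrightarrow> (Wm *v z) $ i = 0" "\<And>z i. \<theta>0 $ i \<noteq> 0 \<Longrightarrow> (J *v (Wm *v z - z)) $ i = 0"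
    and z: "\<And>n. z n \<in> borel_measurable M"
    and tight: "\<And>e. 0 < e \<Longrightarrow> \<exists>K. \<forall>\<^sub>F n in sequentially. measure M {\<omega> \<in> space M. K < norm (z n \<omega>)} < e"
    and hess: "conv_in_prob M (\<lambda>n \<omega>. phi_pow (1/2) \<Delta> n ** Hs n \<omega> ** phi_pow (1/2) \<Delta> n) (\<lambda>_. J) sequentially"
    and min: "\<And>n. AE \<omega> in M. is_arg_min (lasso_objective (Hs n \<omega>) (\<theta>t n \<omega>) (l n) (g n)) (\<lambda>\<theta>. \<theta> \<in> \<Theta>) (\<theta>h n \<omega>)"
    and \<delta>: "0 < \<delta>"
  shows "(\<lambda>n. measure M {\<omega> \<in> space M. \<delta> < norm (u n \<omega> - Wm *v z n \<omega>)}) \<longlonglongrightarrow> 0"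
proof (rule tendstoI)
  interpret prob_space M by fact
  fix e :: real assume e: "0 < e"
  obtain c where c: "0 < c" "\<And>v. c * (norm v)\<^sup>2 \<le> v \<bullet> (J *v v)"
    using pos_definite_coercive[OF J] by blast
  obtain K0 where K0: "\<forall>\<^sub>F n in sequentially. prob {\<omega> \<in> space M. K0 < norm (z n \<omega>)} < e / 2"
    using tight[of "e / 2"] e by auto
  define K where "K = max K0 0"
  define R where "R = (norm Wm + 1) * K"
  define N where "N = real CARD('p + 'q)"
  \<comment> \<open>These make the bound at most \<open>c * \<delta> / 8 + c * \<delta> / 4\<close>,
    which is below \<open>c * \<delta> / 2\<close>. The denominator \<open>R + 1\<close> covers the
    case \<open>R = 0\<close>.\<close>
  define \<epsilon> where "\<epsilon> = c * \<delta> / (8 * N)"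
  define \<eta> where "\<eta> = min (c / 2) (c * \<delta> / 8 / (R + 1))"
  have K: "0 \<le> K" "K0 \<le> K" by (auto simp: K_def)
  have R: "0 \<le> R" using K by (simp add: R_def)
  have N: "0 < N"
    unfolding N_def by (simp only: of_nat_0_less_iff zero_less_card_finite)
  have \<epsilon>: "0 < \<epsilon>" and \<eta>: "0 < \<eta>"
    using c \<delta> R N by (auto simp: \<epsilon>_def \<eta>_def)
  have \<eta>c: "\<eta> \<le> c / 2"
    unfolding \<eta>_def by (rule min.cobounded1)
  have small: "N * \<epsilon> + 2 * \<eta> * R < c / 2 * \<delta>"
  proof -
    have "\<eta> * R \<le> c * \<delta> / 8 / (R + 1) * (R + 1)"
      using R c \<delta> by (intro mult_mono) (auto simp: \<eta>_def)
    moreover have "a / (R + 1) * (R + 1) = a" for a :: real using R by simp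
    ultimately have "\<eta> * R \<le> c * \<delta> / 8" by (simp only:)
    moreover have "N * \<epsilon> = c * \<delta> / 8" using N by (simp add: \<epsilon>_def)
    moreover have "0 < c * \<delta>" using c \<delta> by simp
    ultimately show ?thesis by simp
  qed
  let ?A = "\<lambda>n \<omega>. phi_pow (1/2) \<Delta> n ** Hs n \<omega> ** phi_pow (1/2) \<Delta> n"
  have mA: "\<forall>\<^sub>F n in sequentially. ?A n \<in> borel_measurable M"
    and limA: "(\<lambda>n. prob {\<omega> \<in> space M. \<eta> < dist (?A n \<omega>) J}) \<longlonglongrightarrow> 0"
    using hess \<eta> by (auto simp: conv_in_prob_def)
  from limA have A: "\<forall>\<^sub>F n in sequentially. prob {\<omega> \<in> space M. \<eta> < dist (?A n \<omega>) J} < e / 2"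
    using e by (intro order_tendstoD) auto
  have act: "\<forall>\<^sub>F n in sequentially. \<forall>i. \<theta>0 $ i \<noteq> 0 \<longrightarrow> case_sum (l n) (g n) i / s n i \<le> \<epsilon>"
  proof (intro eventually_all_finite)
    fix i
    show "\<forall>\<^sub>F n in sequentially. \<theta>0 $ i \<noteq> 0 \<longrightarrow> case_sum (l n) (g n) i / s n i \<le> \<epsilon>"
    proof (cases "\<theta>0 $ i = 0")
      case False
      then have "\<forall>\<^sub>F n in sequentially. case_sum (l n) (g n) i / s n i < \<epsilon>"
        using active[of i] \<epsilon> by (intro order_tendstoD) auto
      then show ?thesis by eventually_elim auto
    qed simp
  qed
  have inact: "\<forall>\<^sub>F n in sequentially. \<forall>i. \<theta>0 $ i = 0 \<longrightarrow> 2 * (norm J * R) \<le> case_sum (l n) (g n) i / s n i"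
  proof (intro eventually_all_finite)
    fix i
    show "\<forall>\<^sub>F n in sequentially. \<theta>0 $ i = 0 \<longrightarrow> 2 * (norm J * R) \<le> case_sum (l n) (g n) i / s n i"
    proof (cases "\<theta>0 $ i = 0")
      case True
      then have "\<forall>\<^sub>F n in sequentially. 2 * (norm J * R) \<le> case_sum (l n) (g n) i / s n i"
        using inactive[of i] by (simp add: filterlim_at_top)
      then show ?thesis by eventually_elim auto
    qed simp
  qed
  \<comment> \<open>The comparison point must be an admissible parameter. Since
    \<open>\<Theta>\<close> is open, it is enough that its distance to \<open>\<theta>0\<close>,
    bounded by the sum over \<open>i\<close> below whenever \<open>norm z \<le> K\<close>, tends to
    0.\<close>
  obtain \<rho> where \<rho>: "0 < \<rho>" "ball \<theta>0 \<rho> \<subseteq> \<Theta>"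
    using \<Theta> by (meson open_contains_ball)
  have s_top: "filterlim (\<lambda>n. s n i) at_top sequentially" for i
  proof (cases i)
    case (Inl j)
    show ?thesis unfolding Inl s_def rate_powr_minus_half(1)[OF \<Delta>(1)]
      by (rule filterlim_compose[OF sqrt_at_top \<Delta>(2)])
  next
    case (Inr k)
    show ?thesis unfolding Inr s_def rate_powr_minus_half(2)[OF \<Delta>(1)]
      by (rule filterlim_compose[OF sqrt_at_top filterlim_real_sequentially])
  qed
  have "(\<lambda>n. \<Sum>i\<in>UNIV. norm Wm * K * inverse (s n i)) \<longlonglongrightarrow> (\<Sum>i\<in>(UNIV::('p + 'q) set). norm Wm * K * 0)"
    by (intro tendsto_intros tendsto_inverse_0_at_top s_top)
  then have "\<forall>\<^sub>F n in sequentially. (\<Sum>i\<in>UNIV. norm Wm * K * inverse (s n i)) < \<rho>"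
    using \<rho>(1) by (intro order_tendstoD) auto
  with K0 A mA act inact eventually_gt_at_top[of 0]
  show "\<forall>\<^sub>F n in sequentially. dist (prob {\<omega> \<in> space M. \<delta> < norm (u n \<omega> - Wm *v z n \<omega>)}) 0 < e"
  proof eventually_elim
    case (elim n)
    note [measurable] = z[of n] elim(3)
    let ?B = "{\<omega> \<in> space M. K0 < norm (z n \<omega>)}" and ?C = "{\<omega> \<in> space M. \<eta> < dist (?A n \<omega>) J}"
    have ev: "?B \<in> events" "?C \<in> events" by measurable
    have s: "0 < s n i" for i
      using rate_pos[of n \<Delta> i, OF elim(6) \<Delta>(1)] by (simp add: s_def)
    have half: "rate \<Delta> n i powr (1/2) = inverse (s n i)" for i
      unfolding s_def by (rule powr_half_eq)
    \<comment> \<open>The minimising property holds almost surely, so the inclusion of events is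
      proved up to a null set.\<close>
    have "AE \<omega> in M. \<omega> \<in> {\<omega> \<in> space M. \<delta> < norm (u n \<omega> - Wm *v z n \<omega>)} \<longrightarrow> \<omega> \<in> ?B \<union> ?C"
      using min[of n] AE_space
    proof eventually_elim
      case \<omega>: (elim \<omega>)
      show ?case
      proof (rule ccontr)
        assume neg: "\<not> ?case"
        then have zK: "norm (z n \<omega>) \<le> K" and A\<eta>: "norm (?A n \<omega> - J) \<le> \<eta>"
          and big: "\<delta> < norm (u n \<omega> - Wm *v z n \<omega>)"
          using \<omega> K by (auto simp: dist_norm)
        have wK: "norm (Wm *v z n \<omega>) \<le> norm Wm * K"
          using norm_matrix_vector_mult_le[of Wm "z n \<omega>"] mult_left_mono[OF zK norm_ge_zero[of Wm]] by linarith
        have wz: "norm (Wm *v z n \<omega> - z n \<omega>) \<le> R"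
          using norm_triangle_ineq4[of "Wm *v z n \<omega>" "z n \<omega>"] wK zK by (simp add: R_def algebra_simps)
        have Jwz: "norm (J *v (Wm *v z n \<omega> - z n \<omega>)) \<le> norm J * R"
          using norm_matrix_vector_mult_le[of J "Wm *v z n \<omega> - z n \<omega>"] mult_left_mono[OF wz norm_ge_zero[of J]] by linarith
        have "norm (phi_pow (1/2) \<Delta> n *v (Wm *v z n \<omega>)) \<le> (\<Sum>i\<in>UNIV. \<bar>(phi_pow (1/2) \<Delta> n *v (Wm *v z n \<omega>)) $ i\<bar>)"
          by (rule norm_le_l1_cart)
        also have "\<dots> \<le> (\<Sum>i\<in>UNIV. norm Wm * K * inverse (s n i))"
        proof (rule sum_mono)
          fix i
          have "\<bar>(Wm *v z n \<omega>) $ i\<bar> \<le> norm Wm * K"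
            using component_le_norm_cart wK order_trans by blast
          then have "\<bar>(Wm *v z n \<omega>) $ i\<bar> * inverse (s n i) \<le> norm Wm * K * inverse (s n i)"
            using s[of i] by (intro mult_right_mono) auto
          then show "\<bar>(phi_pow (1/2) \<Delta> n *v (Wm *v z n \<omega>)) $ i\<bar> \<le> norm Wm * K * inverse (s n i)"
            using s[of i] by (simp add: half abs_mult mult.commute)
        qed
        also have "\<dots> < \<rho>" by (rule elim(7))
        finally have in\<Theta>: "\<theta>0 + phi_pow (1/2) \<Delta> n *v (Wm *v z n \<omega>) \<in> \<Theta>"
          by (intro subsetD[OF \<rho>(2)]) (simp add: dist_norm)
        have "c / 2 * norm (u n \<omega> - Wm *v z n \<omega>) \<le> N * \<epsilon> + 2 * \<eta> * R"
          unfolding u_def N_def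
        proof (rule lasso_minimizer_bound[OF elim(6) \<Delta>(1) \<omega>(1) in\<Theta> c(2)])
          show "transpose J = J" using J by (simp add: pos_definite_def)
          show "0 \<le> case_sum (l n) (g n) i" for i
            using l by (cases i) (auto intro: less_imp_le)
          show "2 * norm (J *v (Wm *v z n \<omega> - phi_pow (-1/2) \<Delta> n *v (\<theta>t n \<omega> - \<theta>0)))
              \<le> case_sum (l n) (g n) i / rate \<Delta> n i powr (-1/2)" if "\<theta>0 $ i = 0" for i
          proof -
            have "2 * norm (J *v (Wm *v z n \<omega> - z n \<omega>)) \<le> case_sum (l n) (g n) i / s n i"
              using elim(5) that Jwz by fastforce
            then show ?thesis by (simp add: z_def s_def)
          qed
          show "norm (Wm *v z n \<omega> - phi_pow (-1/2) \<Delta> n *v (\<theta>t n \<omega> - \<theta>0)) \<le> R"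
            using wz by (simp add: z_def)
          show "(J *v (Wm *v z n \<omega> - phi_pow (-1/2) \<Delta> n *v (\<theta>t n \<omega> - \<theta>0))) $ i = 0" if "\<theta>0 $ i \<noteq> 0" for i
            using W(2)[OF that, of "z n \<omega>"] by (simp add: z_def)
          show "case_sum (l n) (g n) i / rate \<Delta> n i powr (-1/2) \<le> \<epsilon>" if "\<theta>0 $ i \<noteq> 0" for i
            using elim(4) that by (simp add: s_def)
        qed (use W(1) A\<eta> \<eta>c \<epsilon> in auto)
        also note small
        finally show False
          using big c(1) by simp
      qed
    qed
    then have "prob {\<omega> \<in> space M. \<delta> < norm (u n \<omega> - Wm *v z n \<omega>)} \<le> prob (?B \<union> ?C)"
      using ev by (intro finite_measure_mono_AE) auto
    also have "\<dots> \<le> prob ?B + prob ?C"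
      using ev by (rule measure_Un_le)
    also have "\<dots> < e" using elim(1,2) by simp
    finally show ?case by (simp add: dist_real_def)
  qed
qed

section \<open>Normalisation, measurability and tuning conditions\<close>

text \<open>The constant test function 1 gives the limit total mass 1. Thus normalisation of the
  Gaussian limit follows from the assumed convergence, without evaluating its integral.\<close>

lemma conv_in_dist_prob_space:
  fixes Y :: "nat \<Rightarrow> 'w \<Rightarrow> 'a::metric_space"
  assumes "prob_space M" and Y: "conv_in_dist M Y L"
  shows "prob_space L"
proof
  interpret M: prob_space M by fact
  have "continuous_on UNIV (\<lambda>_::'a. 1::real) \<and> bounded (range (\<lambda>_::'a. 1::real))"
    by auto
  then have "(\<lambda>n. \<integral>\<omega>. (1::real) \<partial>M) \<longlonglongrightarrow> (\<integral>y. 1 \<partial>L)"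
    using Y unfolding conv_in_dist_def by blast
  then have "measure L (space L) = 1"
    by (simp add: M.prob_space LIMSEQ_const_iff)
  \<comment> \<open>Infinite total mass would make \<open>measure\<close> return 0, so the value 1
    excludes it.\<close>
  then show "emeasure L (space L) = 1"
    by (metis emeasure_eq_ennreal_measure ennreal_1 measure_zero_top zero_neq_one)
qed

lemma norm_sub_vec_le:
  assumes "inj \<iota>"
  shows "norm (sub_vec \<iota> v) \<le> norm v"
proof -
  have "(\<Sum>s\<in>UNIV. (v $ \<iota> s)\<^sup>2) = (\<Sum>i\<in>range \<iota>. (v $ i)\<^sup>2)"
    using assms by (simp add: sum.reindex)
  also have "\<dots> \<le> (\<Sum>i\<in>UNIV. (v $ i)\<^sup>2)"
    by (intro sum_mono2) auto
  finally show ?thesis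
    by (simp add: norm_vec_def L2_set_def sub_vec_def)
qed

lemma sub_vec_diff: "sub_vec \<iota> (x - y) = sub_vec \<iota> x - sub_vec \<iota> y"
  by (simp add: sub_vec_def vec_eq_iff)

lemma open_param_space:
  assumes "open Tp" "open Tq"
  shows "open (param_space Tp Tq)"
proof -
  have "param_space Tp Tq = drift_par -` Tp \<inter> diff_par -` Tq"
    by (auto simp: param_space_def)
  moreover have "continuous_on UNIV (drift_par :: real^('a + 'b) \<Rightarrow> _)" "continuous_on UNIV (diff_par :: real^('a + 'b) \<Rightarrow> _)"
    unfolding drift_par_def diff_par_def by (intro continuous_intros)+
  ultimately show ?thesis
    using assms by (simp add: open_Int open_vimage)
qed

lemma sample_measurable:
  assumes X: "sde_solution M F W X drift diff" and \<Delta>: "0 < \<Delta> n"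
  shows "sample X \<Delta> n \<in> M \<rightarrow>\<^sub>M sample_space n"
proof -
  have "X t \<in> borel_measurable M" if "0 \<le> t" for t
    using X that unfolding sde_solution_def brownian_motion_def
    by (metis measurable_from_subalg)
  then show ?thesis
    unfolding sample_def using \<Delta> by (intro measurable_restrict) simp
qed

text \<open>In the application \<open>r 0 = 0\<close>; division by it yields 0, so the comparison
  with the maximum holds for every \<open>n\<close>.\<close>

lemma tendsto_0_of_Max:
  fixes l :: "nat \<Rightarrow> 'a::finite \<Rightarrow> real"
  assumes l: "\<And>n j. 0 < l n j" and r: "\<And>n. 0 \<le> r n" and j: "j \<in> S"
    and lim: "S \<noteq> {} \<longrightarrow> (\<lambda>n. Max (l n ` S) / r n) \<longlonglongrightarrow> 0"
  shows "(\<lambda>n. l n j / r n) \<longlonglongrightarrow> 0"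
proof (rule tendsto_sandwich[OF _ _ tendsto_const])
  show "(\<lambda>n. Max (l n ` S) / r n) \<longlonglongrightarrow> 0"
    using lim j by blast
  show "\<forall>\<^sub>F n in sequentially. 0 \<le> l n j / r n"
    using l r by (intro always_eventually allI divide_nonneg_nonneg) (auto intro: less_imp_le)
  show "\<forall>\<^sub>F n in sequentially. l n j / r n \<le> Max (l n ` S) / r n"
    using j r by (intro always_eventually allI divide_right_mono) auto
qed

lemma at_top_of_Min:
  fixes l :: "nat \<Rightarrow> 'a::finite \<Rightarrow> real"
  assumes r: "\<And>n. 0 \<le> r n" and j: "j \<in> S"
    and lim: "S \<noteq> {} \<longrightarrow> filterlim (\<lambda>n. Min (l n ` S) / r n) at_top sequentially"
  shows "filterlim (\<lambda>n. l n j / r n) at_top sequentially"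
proof (rule filterlim_at_top_mono)
  show "filterlim (\<lambda>n. Min (l n ` S) / r n) at_top sequentially"
    using lim j by blast
  show "\<forall>\<^sub>F n in sequentially. Min (l n ` S) / r n \<le> l n j / r n"
    using j r by (intro always_eventually allI divide_right_mono) auto
qed

section \<open>Asymptotic normality of the active part of the estimator\<close>

theorem theorem3:
  fixes \<Theta>p :: "(real^'p) set" and \<Theta>q :: "(real^'q) set" and \<Theta> :: "(real^('p::finite + 'q::finite)) set"
    and b :: "real^'p \<Rightarrow> real^'d \<Rightarrow> real^'d"
    and \<sigma> :: "real^'q \<Rightarrow> real^'d \<Rightarrow> real^'d^'d"
    and M :: "real^('p::finite + 'q::finite) \<Rightarrow> 'w measure"
    and Fl :: "real^('p::finite + 'q::finite) \<Rightarrow> real \<Rightarrow> 'w measure"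
    and W X :: "real^('p::finite + 'q::finite) \<Rightarrow> real \<Rightarrow> 'w \<Rightarrow> real^'d"
    and \<mu> :: "real^('p::finite + 'q::finite) \<Rightarrow> (real^'d) measure"
    and \<theta>0 :: "real^('p::finite + 'q::finite)"
    and \<Delta> :: "nat \<Rightarrow> real"
    and H :: "nat \<Rightarrow> (nat \<Rightarrow> real^'d) \<Rightarrow> real^('p::finite + 'q::finite) \<Rightarrow> real"
    and \<theta>t \<theta>h :: "nat \<Rightarrow> (nat \<Rightarrow> real^'d) \<Rightarrow> real^('p::finite + 'q::finite)"
    and lam :: "nat \<Rightarrow> 'p \<Rightarrow> real" and gam :: "nat \<Rightarrow> 'q \<Rightarrow> real"
    and \<iota> :: "'s::finite \<Rightarrow> 'p + 'q"
  assumes Theta: "\<Theta> = param_space \<Theta>p \<Theta>q" "open \<Theta>p" "open \<Theta>q"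
    and true_par: "\<theta>0 \<in> \<Theta>"
    and model: "\<forall>\<theta>\<in>\<Theta>. sde_solution (M \<theta>) (Fl \<theta>) (W \<theta>) (X \<theta>)
                  (b (drift_par \<theta>)) (\<sigma> (diff_par \<theta>))"
    and design: "\<forall>n. 0 < \<Delta> n"
      "filterlim (\<lambda>n. real n * \<Delta> n) at_top sequentially"
      "\<Delta> \<longlonglongrightarrow> 0"
      "(\<lambda>n. real n * (\<Delta> n)\<^sup>2) \<longlonglongrightarrow> 0"
    and lipschitz: "\<exists>C. \<forall>x y. norm (b (drift_par \<theta>0) x - b (drift_par \<theta>0) y)
                  + norm (\<sigma> (diff_par \<theta>0) x - \<sigma> (diff_par \<theta>0) y) \<le> C * norm (x - y)"
    and nondegenerate: "0 < (INF (\<beta>, x)\<in>\<Theta>q \<times> UNIV. det (Sigma_mat \<sigma> \<beta> x))"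
    and ergodic: "\<forall>\<theta>\<in>\<Theta>. ergodic_diffusion (M \<theta>) (X \<theta>)
                  (b (drift_par \<theta>)) (\<sigma> (diff_par \<theta>)) (\<mu> \<theta>)"
    and moments: "\<forall>(m::nat). \<forall>\<theta>\<in>\<Theta>. \<exists>K. \<forall>t\<ge>0. integrable (M \<theta>) (\<lambda>\<omega>. norm (X \<theta> t \<omega>) ^ m)
                  \<and> (\<integral>\<omega>. norm (X \<theta> t \<omega>) ^ m \<partial>M \<theta>) \<le> K"
    and smooth_x_b: "\<forall>\<alpha>\<in>\<Theta>p. times_differentiable_on 5 (b \<alpha>) UNIV"
      "\<forall>ks. 1 \<le> length ks \<and> length ks \<le> 5 \<longrightarrow> poly_bounded \<Theta>p (\<lambda>\<alpha>. partials ks (b \<alpha>))"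
    and smooth_x_\<sigma>: "\<forall>\<beta>\<in>\<Theta>q. times_differentiable_on 5 (\<sigma> \<beta>) UNIV"
      "\<forall>ks. 1 \<le> length ks \<and> length ks \<le> 5 \<longrightarrow> poly_bounded \<Theta>q (\<lambda>\<beta>. partials ks (\<sigma> \<beta>))"
    and smooth_par_b: "\<forall>ks. length ks \<le> 2 \<longrightarrow>
      (\<forall>x. times_differentiable_on 3 (\<lambda>\<alpha>. partials ks (b \<alpha>) x) \<Theta>p) \<and>
      (\<forall>js. 1 \<le> length js \<and> length js \<le> 3 \<longrightarrow>
         poly_bounded \<Theta>p (\<lambda>\<alpha> x. partials js (\<lambda>\<alpha>'. partials ks (b \<alpha>') x) \<alpha>))"
    and smooth_par_\<sigma>: "\<forall>ks. length ks \<le> 2 \<longrightarrow>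
      (\<forall>x. times_differentiable_on 3 (\<lambda>\<beta>. partials ks (\<sigma> \<beta>) x) \<Theta>q) \<and>
      (\<forall>js. 1 \<le> length js \<and> length js \<le> 3 \<longrightarrow>
         poly_bounded \<Theta>q (\<lambda>\<beta> x. partials js (\<lambda>\<beta>'. partials ks (\<sigma> \<beta>') x) \<beta>))"
    and identifiable: "\<forall>\<alpha>\<in>\<Theta>p. \<forall>\<beta>\<in>\<Theta>q.
      (AE x in \<mu> \<theta>0. b \<alpha> x = b (drift_par \<theta>0) x \<and> \<sigma> \<beta> x = \<sigma> (diff_par \<theta>0) x) \<longrightarrow>
      \<alpha> = drift_par \<theta>0 \<and> \<beta> = diff_par \<theta>0"
    and info_pos: "\<forall>\<theta>\<in>\<Theta>. pos_definite (info b \<sigma> (\<mu> \<theta>) \<theta>)"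
    and contrast_measurable: "\<forall>n. \<forall>\<theta>\<in>\<Theta>. (\<lambda>x. H n x \<theta>) \<in> borel_measurable (sample_space n)"
    and contrast_differentiable: "\<forall>n. \<forall>x\<in>space (sample_space n). times_differentiable_on 2 (H n x) \<Theta>"
    and hessian_limit: "\<forall>\<theta>\<in>\<Theta>. conv_in_prob (M \<theta>)
      (\<lambda>n \<omega>. scaled_hessian H \<Delta> n (sample (X \<theta>) \<Delta> n \<omega>) \<theta>) (\<lambda>_. info b \<sigma> (\<mu> \<theta>) \<theta>) sequentially"
    and hessian_plug_in: "hessian_equicontinuous_along (M \<theta>0) (sample (X \<theta>0) \<Delta>) H \<Delta> \<theta>t \<theta>0"
    and initial_measurable: "\<forall>n. \<theta>t n \<in> borel_measurable (sample_space n)"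
    and initial_argmin: "\<forall>\<theta>\<in>\<Theta>. \<forall>n. AE \<omega> in M \<theta>. is_arg_min (H n (sample (X \<theta>) \<Delta> n \<omega>))
      (\<lambda>\<theta>'. \<theta>' \<in> \<Theta>) (\<theta>t n (sample (X \<theta>) \<Delta> n \<omega>))"
    and initial_consistent: "\<forall>\<theta>\<in>\<Theta>. conv_in_prob (M \<theta>)
      (\<lambda>n \<omega>. \<theta>t n (sample (X \<theta>) \<Delta> n \<omega>)) (\<lambda>_. \<theta>) sequentially"
    and initial_normal: "\<forall>\<theta>\<in>\<Theta>. conv_in_dist (M \<theta>)
      (\<lambda>n \<omega>. phi_pow (-1/2) \<Delta> n *v (\<theta>t n (sample (X \<theta>) \<Delta> n \<omega>) - \<theta>))
      (multi_normal 0 (matrix_inv (info b \<sigma> (\<mu> \<theta>) \<theta>)))"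
    and tuning_pos: "\<forall>n j. 0 < lam n j" "\<forall>n k. 0 < gam n k"
    and active: "bij_betw \<iota> UNIV {i. \<theta>0 $ i \<noteq> 0}"
    and tuning_active:
      "{j. drift_par \<theta>0 $ j \<noteq> 0} \<noteq> {} \<longrightarrow>
        (\<lambda>n. Max (lam n ` {j. drift_par \<theta>0 $ j \<noteq> 0}) / sqrt (real n * \<Delta> n)) \<longlonglongrightarrow> 0"
      "{k. diff_par \<theta>0 $ k \<noteq> 0} \<noteq> {} \<longrightarrow>
        (\<lambda>n. Max (gam n ` {k. diff_par \<theta>0 $ k \<noteq> 0}) / sqrt (real n)) \<longlonglongrightarrow> 0"
    and tuning_inactive:
      "{j. drift_par \<theta>0 $ j = 0} \<noteq> {} \<longrightarrow> filterlim
        (\<lambda>n. Min (lam n ` {j. drift_par \<theta>0 $ j = 0}) / sqrt (real n * \<Delta> n)) at_top sequentially"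
      "{k. diff_par \<theta>0 $ k = 0} \<noteq> {} \<longrightarrow> filterlim
        (\<lambda>n. Min (gam n ` {k. diff_par \<theta>0 $ k = 0}) / sqrt (real n)) at_top sequentially"
    and lasso_measurable: "\<forall>n. \<theta>h n \<in> borel_measurable (sample_space n)"
    and lasso_argmin: "\<forall>n. AE \<omega> in M \<theta>0. let x = sample (X \<theta>0) \<Delta> n \<omega> in
      is_arg_min (lasso_objective (hessian (H n x) (\<theta>t n x)) (\<theta>t n x) (lam n) (gam n))
        (\<lambda>\<theta>'. \<theta>' \<in> \<Theta>) (\<theta>h n x)"
  shows "conv_in_dist (M \<theta>0)
      (\<lambda>n \<omega>. diag_mat (\<lambda>s. rate \<Delta> n (\<iota> s) powr (-1/2)) *v
         (sub_vec \<iota> (\<theta>h n (sample (X \<theta>0) \<Delta> n \<omega>)) - sub_vec \<iota> \<theta>0))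
      (multi_normal 0 (matrix_inv (sub_mat \<iota> (info b \<sigma> (\<mu> \<theta>0) \<theta>0))))"
proof -
  define S where "S = (\<lambda>n \<omega>. sample (X \<theta>0) \<Delta> n \<omega>)"
  define J where "J = info b \<sigma> (\<mu> \<theta>0) \<theta>0"
  define z where "z = (\<lambda>n \<omega>. phi_pow (-1/2) \<Delta> n *v (\<theta>t n (S n \<omega>) - \<theta>0))"
  define u where "u = (\<lambda>n \<omega>. phi_pow (-1/2) \<Delta> n *v (\<theta>h n (S n \<omega>) - \<theta>0))"
  define T where "T = (\<lambda>z. matrix_inv (sub_mat \<iota> J) *v sub_vec \<iota> (J *v z))"
  have sde: "sde_solution (M \<theta>0) (Fl \<theta>0) (W \<theta>0) (X \<theta>0) (b (drift_par \<theta>0)) (\<sigma> (diff_par \<theta>0))"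
    using model true_par by blast
  then have M: "prob_space (M \<theta>0)"
    by (simp add: sde_solution_def brownian_motion_def)
  have J: "pos_definite J"
    using info_pos true_par by (simp add: J_def)
  have \<iota>: "inj \<iota>" and range: "range \<iota> = {i. \<theta>0 $ i \<noteq> 0}"
    using active by (auto simp: bij_betw_def)
  have [measurable]: "S n \<in> M \<theta>0 \<rightarrow>\<^sub>M sample_space n" for n
    unfolding S_def using sample_measurable[OF sde] design(1) by simp
  note [measurable] = initial_measurable[rule_format] lasso_measurable[rule_format]
  have z: "z n \<in> borel_measurable (M \<theta>0)" and u: "u n \<in> borel_measurable (M \<theta>0)" for n
    unfolding z_def u_def by measurable
  have normal: "conv_in_dist (M \<theta>0) z (multi_normal 0 (matrix_inv J))"
    using initial_normal true_par by (simp add: z_def S_def J_def)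
  have L: "prob_space (multi_normal 0 (matrix_inv J))"
    by (rule conv_in_dist_prob_space[OF M normal])
  obtain Wm where Wm: "\<And>z. sub_vec \<iota> (Wm *v z) = T z"
      "\<And>z i. i \<notin> range \<iota> \<Longrightarrow> (Wm *v z) $ i = 0"
      "\<And>z i. i \<in> range \<iota> \<Longrightarrow> (J *v (Wm *v z - z)) $ i = 0"
    unfolding T_def using restricted_minimizer[OF J \<iota>] by blast
  \<comment> \<open>The objective uses the Hessian at the random initial estimator; its limit is the
    one at \<open>\<theta>0\<close>, transferred by stochastic equicontinuity.\<close>
  have "conv_in_prob (M \<theta>0) (\<lambda>n \<omega>. scaled_hessian H \<Delta> n (S n \<omega>) (\<theta>t n (S n \<omega>))) (\<lambda>_. J) sequentially"
  proof (rule conv_in_prob_close[OF M])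
    show "conv_in_prob (M \<theta>0) (\<lambda>n \<omega>. scaled_hessian H \<Delta> n (S n \<omega>) \<theta>0) (\<lambda>_. J) sequentially"
      using hessian_limit true_par by (simp add: S_def J_def)
    show "conv_in_prob (M \<theta>0) (\<lambda>n \<omega>. scaled_hessian H \<Delta> n (S n \<omega>) (\<theta>t n (S n \<omega>))
        - scaled_hessian H \<Delta> n (S n \<omega>) \<theta>0) (\<lambda>_. 0) sequentially"
      using hessian_plug_in by (simp add: S_def hessian_equicontinuous_along_def)
  qed
  then have hess: "conv_in_prob (M \<theta>0) (\<lambda>n \<omega>. phi_pow (1/2) \<Delta> n ** hessian (H n (S n \<omega>)) (\<theta>t n (S n \<omega>))
      ** phi_pow (1/2) \<Delta> n) (\<lambda>_. J) sequentially"
    by (simp add: scaled_hessian_def)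
  have sqrt_nonneg: "0 \<le> sqrt (real n * \<Delta> n)" for n
    using design(1) by (simp add: less_imp_le)
  have ratio_active: "(\<lambda>n. case_sum (lam n) (gam n) i / rate \<Delta> n i powr (-1/2)) \<longlonglongrightarrow> 0" if "\<theta>0 $ i \<noteq> 0" for i
  proof (cases i)
    case (Inl j)
    then have "j \<in> {j. drift_par \<theta>0 $ j \<noteq> 0}"
      using that by (simp add: drift_par_def)
    from tendsto_0_of_Max[OF tuning_pos(1)[rule_format] sqrt_nonneg this tuning_active(1)]
    show ?thesis
      unfolding Inl rate_powr_minus_half(1)[of \<Delta>, OF design(1)[rule_format]] by simp
  next
    case (Inr k)
    then have "k \<in> {k. diff_par \<theta>0 $ k \<noteq> 0}"
      using that by (simp add: diff_par_def)
    from tendsto_0_of_Max[OF tuning_pos(2)[rule_format] real_sqrt_ge_zero[OF of_nat_0_le_iff] this tuning_active(2)]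
    show ?thesis
      unfolding Inr rate_powr_minus_half(2)[of \<Delta>, OF design(1)[rule_format]] by simp
  qed
  have ratio_inactive: "filterlim (\<lambda>n. case_sum (lam n) (gam n) i / rate \<Delta> n i powr (-1/2)) at_top sequentially"
    if "\<theta>0 $ i = 0" for i
  proof (cases i)
    case (Inl j)
    then have "j \<in> {j. drift_par \<theta>0 $ j = 0}"
      using that by (simp add: drift_par_def)
    from at_top_of_Min[OF sqrt_nonneg this tuning_inactive(1)]
    show ?thesis
      unfolding Inl rate_powr_minus_half(1)[of \<Delta>, OF design(1)[rule_format]] by simp
  next
    case (Inr k)
    then have "k \<in> {k. diff_par \<theta>0 $ k = 0}"
      using that by (simp add: diff_par_def)
    from at_top_of_Min[OF real_sqrt_ge_zero[OF of_nat_0_le_iff] this tuning_inactive(2)]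
    show ?thesis
      unfolding Inr rate_powr_minus_half(2)[of \<Delta>, OF design(1)[rule_format]] by simp
  qed
  have near: "(\<lambda>n. measure (M \<theta>0) {\<omega> \<in> space (M \<theta>0). \<delta> < norm (u n \<omega> - Wm *v z n \<omega>)}) \<longlonglongrightarrow> 0"
    if \<delta>: "0 < \<delta>" for \<delta>
    unfolding u_def z_def
  proof (rule lasso_minimizer_near_projection[OF M J _ true_par _ design(2) _ _ ratio_active ratio_inactive _ _ _ _ hess _ \<delta>])
    show "open \<Theta>"
      unfolding Theta(1) by (rule open_param_space[OF Theta(2,3)])
    show "0 < \<Delta> n" for n using design(1) by blast
    show "0 < lam n j" "0 < gam n k" for n j k using tuning_pos by auto
    show "(Wm *v z) $ i = 0" if "\<theta>0 $ i = 0" for z i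
      using that range by (intro Wm(2)) auto
    show "(J *v (Wm *v z - z)) $ i = 0" if "\<theta>0 $ i \<noteq> 0" for z i
      using that range by (intro Wm(3)) auto
    show "(\<lambda>\<omega>. phi_pow (-1/2) \<Delta> n *v (\<theta>t n (S n \<omega>) - \<theta>0)) \<in> borel_measurable (M \<theta>0)" for n
      using z unfolding z_def .
    show "\<exists>K. \<forall>\<^sub>F n in sequentially. measure (M \<theta>0)
        {\<omega> \<in> space (M \<theta>0). K < norm (phi_pow (-1/2) \<Delta> n *v (\<theta>t n (S n \<omega>) - \<theta>0))} < e" if "0 < e" for e
      using conv_in_dist_tight[OF M L sets_multi_normal normal that] unfolding z_def .
    show "AE \<omega> in M \<theta>0. is_arg_min (lasso_objective (hessian (H n (S n \<omega>)) (\<theta>t n (S n \<omega>))) (\<theta>t n (S n \<omega>)) (lam n) (gam n))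
        (\<lambda>\<theta>. \<theta> \<in> \<Theta>) (\<theta>h n (S n \<omega>))" for n
      using lasso_argmin by (simp add: Let_def S_def)
  qed
  have T: "continuous_on UNIV T"
  proof -
    have "T = (*v) (matrix_inv (sub_mat \<iota> J) ** sel_mat \<iota> ** J)"
      by (simp add: T_def fun_eq_iff sel_mat_mult[symmetric] matrix_vector_mul_assoc matrix_mul_assoc)
    then show ?thesis
      by (simp add: matrix_vector_mult_linear_continuous_on)
  qed
  have "conv_in_dist (M \<theta>0) (\<lambda>n \<omega>. sub_vec \<iota> (u n \<omega>)) (distr (multi_normal 0 (matrix_inv J)) borel T)"
  proof (rule slutsky_continuous[OF M L sets_multi_normal normal T])
    interpret prob_space "M \<theta>0" by (rule M)
    note [measurable] = z u
    show "(\<lambda>\<omega>. sub_vec \<iota> (u n \<omega>)) \<in> borel_measurable (M \<theta>0)" for n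
      by measurable
    fix \<delta> :: real assume \<delta>: "0 < \<delta>"
    \<comment> \<open>Restriction does not increase the norm, and \<open>T (z n \<omega>)\<close> is
      the active part of \<open>Wm *v z n \<omega>\<close>, so this event lies inside the one
      handled by \<open>near\<close>.\<close>
    have "prob {\<omega> \<in> space (M \<theta>0). \<delta> < norm (sub_vec \<iota> (u n \<omega>) - T (z n \<omega>))}
        \<le> prob {\<omega> \<in> space (M \<theta>0). \<delta> < norm (u n \<omega> - Wm *v z n \<omega>)}" for n
    proof (rule finite_measure_mono)
      have "norm (sub_vec \<iota> (u n \<omega>) - T (z n \<omega>)) \<le> norm (u n \<omega> - Wm *v z n \<omega>)" for \<omega>
        using norm_sub_vec_le[OF \<iota>, of "u n \<omega> - Wm *v z n \<omega>"] by (simp add: sub_vec_diff Wm(1))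
      then show "{\<omega> \<in> space (M \<theta>0). \<delta> < norm (sub_vec \<iota> (u n \<omega>) - T (z n \<omega>))}
          \<subseteq> {\<omega> \<in> space (M \<theta>0). \<delta> < norm (u n \<omega> - Wm *v z n \<omega>)}"
        using less_le_trans by blast
    qed measurable
    then show "(\<lambda>n. prob {\<omega> \<in> space (M \<theta>0). \<delta> < norm (sub_vec \<iota> (u n \<omega>) - T (z n \<omega>))}) \<longlonglongrightarrow> 0"
      by (intro tendsto_sandwich[OF _ _ tendsto_const near[OF \<delta>]] always_eventually allI) simp_all
  qed
  moreover have "distr (multi_normal 0 (matrix_inv J)) borel T = multi_normal 0 (matrix_inv (sub_mat \<iota> J))"
    unfolding T_def by (rule distr_multi_normal_projection[OF J \<iota>])
  \<comment> \<open>The rescaling is diagonal, hence commutes with restriction to the active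
    coordinates.\<close>
  moreover have "sub_vec \<iota> (u n \<omega>) = diag_mat (\<lambda>s. rate \<Delta> n (\<iota> s) powr (-1/2)) *v
      (sub_vec \<iota> (\<theta>h n (S n \<omega>)) - sub_vec \<iota> \<theta>0)" for n \<omega>
    by (simp add: vec_eq_iff sub_vec_def u_def)
  ultimately show ?thesis
    by (simp add: S_def J_def)
qed

end
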